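(* Let $f(\mathbf{x})=\mathbf{x}^{T}A\mathbf{x}+b^{T}\mathbf{x}+1$ with $A\in\mathbb{R}^{n\times n}$ symmetric and $b\in\mathbb{R}^n$. Then $f$ admits a monic Hermitian determinantal representation of some size, i.e. $f(\mathbf{x})=\det(I_k+x_1A_1+\dots+x_nA_n)$ for some $k\ge1$ and Hermitian $A_j\in\mathbb{C}^{k\times k}$, if and only if at least one of the following holds: (1) $A$ is negative semidefinite; (2) $A-\frac14 bb^{T}$ is negative semidefinite and $\operatorname{rank}(A-\frac14bb^T)\le 3$. Moreover, if $A$ is not negative semidefinite and $f$ has such a representation of some size, then $f$ has one of size $2$. *)

theory Defs
  imports Complex_Main "Jordan_Normal_Form.Schur_Decomposition" "Jordan_Normal_Form.DL_Rank"
begin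

definition hermitian_mat :: "complex mat \<Rightarrow> bool" where
  "hermitian_mat M \<longleftrightarrow> square_mat M \<and> mat_adjoint M = M"

definition quad_poly :: "real mat \<Rightarrow> real vec \<Rightarrow> real vec \<Rightarrow> real" where
  "quad_poly A b x = x \<bullet> (A *\<^sub>v x) + b \<bullet> x + 1"

definition neg_semidef :: "nat \<Rightarrow> real mat \<Rightarrow> bool" where
  "neg_semidef n M \<longleftrightarrow> M \<in> carrier_mat n n \<and> (\<forall>x \<in> carrier_vec n. x \<bullet> (M *\<^sub>v x) \<le> 0)"

definition outer_prod :: "real vec \<Rightarrow> real mat" where
  "outer_prod b = mat (dim_vec b) (dim_vec b) (\<lambda>(i,j). b $ i * b $ j)"

definition pencil :: "nat \<Rightarrow> nat \<Rightarrow> (nat \<Rightarrow> complex mat) \<Rightarrow> real vec \<Rightarrow> complex mat" where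
  "pencil n k As x = mat k k (\<lambda>(r,c). (if r = c then 1 else 0)
       + (\<Sum>j<n. complex_of_real (x $ j) * (As j $$ (r,c))))"

definition has_mhdr :: "nat \<Rightarrow> (real vec \<Rightarrow> real) \<Rightarrow> nat \<Rightarrow> bool" where
  "has_mhdr n f k \<longleftrightarrow> (\<exists>As. (\<forall>j<n. As j \<in> carrier_mat k k \<and> hermitian_mat (As j)) \<and>
      (\<forall>x \<in> carrier_vec n. complex_of_real (f x) = det (pencil n k As x)))"

end

(* Sufficiency: a positive semidefinite form of rank r is a sum of r squares of linear forms, so f is
   1 + b.x - sum l_i(x)^2 in case (1), the determinant of an identity matrix bordered by the l_i, and
   (1 + b.x/2)^2 - l_0(x)^2 - l_1(x)^2 - l_2(x)^2 in case (2), the determinant of a 2x2 Hermitian pencil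
   in Pauli form.

   Necessity: if M(x) = sum x_j A_j represents f, then det (1 + t M(x)) is quadratic in t, so M(x) has at
   most two nonzero eigenvalues, with sum b.x and product x^T A x; hence
   M(x)^3 = (b.x) M(x)^2 - (x^T A x) M(x). If x0^T A x0 > 0, diagonalise M(x0) unitarily as
   diag(d0, d1, 0, ..., 0) with d0 d1 > 0. Applying the cubic identity to M(s x0 + x) for all real s shows
   that every M(x) lives in the upper left 2x2 block. So f has a representation of size 2, and a 2x2
   Hermitian determinant is a square minus three squares of linear forms. *)

theory Submission
  imports Defs
begin

section \<open>Unitary diagonalization of Hermitian matrices\<close>

text \<open>The constant 1/4 comes from completing the square: \<open>f\<close> equals
  \<open>(1 + b.x/2)^2\<close> plus the form of \<open>A - bb^T/4\<close>. The bound 3 is the real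
  dimension of the space of traceless Hermitian 2x2 matrices, on which the determinant is minus a
  sum of three squares. The obstacle in the necessity direction is that the eigenvectors of M(x)
  move with x. A rank bound on each single M(x) does not confine all of them to one common plane,
  and for bordered identities this can indeed fail. The cubic identity helps because it mentions no
  eigenvectors: its entries are polynomial in x. Positivity of \<open>x0^T A x0\<close> enters by
  giving d0 and d1 the same sign; then d0, d1 and d0 + d1 share that sign, and a weighted sum of
  squared moduli can vanish only termwise. As \<open>f\<close> is a function on real vectors,
  coefficients are compared by evaluation at suitable real parameters instead of by multivariate
  polynomial algebra.\<close>

lemma mat_adjoint_dim [simp]:
  "dim_row (mat_adjoint A) = dim_col A" "dim_col (mat_adjoint A) = dim_row A"
  by (simp_all add: mat_adjoint_def)

lemma mat_adjoint_carrier [simp]: "A \<in> carrier_mat n m \<Longrightarrow> mat_adjoint A \<in> carrier_mat m n"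
  by (rule carrier_matI) simp_all

lemma mat_adjoint_index [simp]:
  fixes A :: "complex mat"
  assumes "i < dim_col A" "j < dim_row A"
  shows "mat_adjoint A $$ (i, j) = cnj (A $$ (j, i))"
  using assms by (simp add: mat_adjoint_def mat_of_rows_index)

lemma mat_adjoint_adjoint [simp]: "mat_adjoint (mat_adjoint A) = (A :: complex mat)"
  by (rule eq_matI) auto

lemma mat_adjoint_mult:
  fixes A B :: "complex mat"
  assumes A: "A \<in> carrier_mat n m" and B: "B \<in> carrier_mat m l"
  shows "mat_adjoint (A * B) = mat_adjoint B * mat_adjoint A"
proof (rule eq_matI)
  fix i j assume "i < dim_row (mat_adjoint B * mat_adjoint A)" "j < dim_col (mat_adjoint B * mat_adjoint A)"
  then have ij: "i < l" "j < n" using A B by auto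
  then show "mat_adjoint (A * B) $$ (i, j) = (mat_adjoint B * mat_adjoint A) $$ (i, j)"
    using A B by (simp add: scalar_prod_def mult.commute)
qed (use A B in auto)

lemma hermitian_conjugate:
  fixes H U :: "complex mat"
  assumes H: "H \<in> carrier_mat n n" "mat_adjoint H = H" and U: "U \<in> carrier_mat n n"
  shows "mat_adjoint (mat_adjoint U * H * U) = mat_adjoint U * H * U"
proof -
  have U': "mat_adjoint U \<in> carrier_mat n n" using U by simp
  show ?thesis
    unfolding mat_adjoint_mult[OF mult_carrier_mat[OF U' H(1)] U] mat_adjoint_mult[OF U' H(1)]
      mat_adjoint_adjoint H(2) using assoc_mult_mat[OF U' H(1) U] by simp
qed

lemma four_block_mat_adjoint:
  fixes A B C D :: "complex mat"
  assumes "A \<in> carrier_mat n n" "B \<in> carrier_mat n m" "C \<in> carrier_mat m n" "D \<in> carrier_mat m m"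
  shows "mat_adjoint (four_block_mat A B C D)
    = four_block_mat (mat_adjoint A) (mat_adjoint C) (mat_adjoint B) (mat_adjoint D)"
  by (rule eq_matI, insert assms) auto

lemma block_diag_mult:
  fixes A B C D :: "'a :: comm_ring_1 mat"
  assumes A: "A \<in> carrier_mat n n" and B: "B \<in> carrier_mat n n"
    and C: "C \<in> carrier_mat m m" and D: "D \<in> carrier_mat m m"
  shows "four_block_mat A (0\<^sub>m n m) (0\<^sub>m m n) C * four_block_mat B (0\<^sub>m n m) (0\<^sub>m m n) D
    = four_block_mat (A * B) (0\<^sub>m n m) (0\<^sub>m m n) (C * D)"
  using mult_four_block_mat[OF A zero_carrier_mat zero_carrier_mat C B zero_carrier_mat zero_carrier_mat D]
    assms by auto

text \<open>Gram-Schmidt on a basis that starts with \<open>v\<close> leaves the first vector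
  unchanged, so normalising the result alters \<open>v\<close> only by a scalar.\<close>

lemma ex_unitary_first_col:
  fixes v :: "complex vec"
  assumes v: "v \<in> carrier_vec n" "v \<noteq> 0\<^sub>v n"
  shows "\<exists>W c. W \<in> carrier_mat n n \<and> mat_adjoint W * W = 1\<^sub>m n \<and> col W 0 = c \<cdot>\<^sub>v v"
proof -
  interpret cof_vec_space n "TYPE(complex)" .
  define b where "b = basis_completion v"
  define ws where "ws = gram_schmidt n b"
  have n: "n > 0"
    using v by (cases n) auto
  from basis_completion[OF v, folded b_def]
  have dist_b: "distinct b" and indep: "\<not> lin_dep (set b)" and b: "set b \<subseteq> carrier_vec n"
    and hdb: "hd b = v" and len_b: "length b = n" by auto
  from hdb len_b n obtain vs where bv: "b = v # vs" by (cases b, auto)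
  from gram_schmidt_result[OF b dist_b indep refl, folded ws_def]
  have ws: "set ws \<subseteq> carrier_vec n" "corthogonal ws" "length ws = n"
    by (auto simp: len_b)
  have hdws: "hd ws = v"
    using gram_schmidt_hd[OF v(1), of vs, folded bv] unfolding ws_def .
  have wsi [simp]: "ws ! i \<in> carrier_vec n" if "i < n" for i
    using ws that by auto
  have dim_ws: "dim_vec (ws ! i) = n" if "i < n" for i
    using wsi[OF that] by (rule carrier_vecD)
  \<comment> \<open>Reciprocal norm of the i-th vector. \<open>Re\<close> loses nothing, since a
    conjugate square is real and nonnegative, and \<open>r i\<close> is real, so the adjoint does
    not change it.\<close>
  define r where "r i = complex_of_real (1 / sqrt (Re (ws ! i \<bullet>c ws ! i)))" for i
  have cnj_r: "cnj (r i) = r i" for i by (simp add: r_def)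
  have r: "r i * (r i * (ws ! i \<bullet>c ws ! i)) = 1" if i: "i < n" for i
  proof -
    have "ws ! i \<bullet>c ws ! i \<noteq> 0"
      using corthogonalD[OF ws(2), of i i] i ws(3) by simp
    moreover have "ws ! i \<bullet>c ws ! i \<ge> 0" by (rule conjugate_square_ge_0_vec)
    ultimately have "Re (ws ! i \<bullet>c ws ! i) > 0"
      and im: "complex_of_real (Re (ws ! i \<bullet>c ws ! i)) = ws ! i \<bullet>c ws ! i"
      by (auto simp: less_eq_complex_def complex_eq_iff)
    then have "r i * r i * complex_of_real (Re (ws ! i \<bullet>c ws ! i)) = 1"
      unfolding r_def of_real_mult[symmetric] by (simp add: field_simps)
    then show ?thesis unfolding im by (simp add: mult.assoc)
  qed
  define W where "W = mat n n (\<lambda>(i, j). r j * ws ! j $ i)"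
  have W: "W \<in> carrier_mat n n" by (simp add: W_def)
  have "mat_adjoint W * W = 1\<^sub>m n"
  proof (rule eq_matI)
    fix i j assume "i < dim_row (1\<^sub>m n :: complex mat)" "j < dim_col (1\<^sub>m n :: complex mat)"
    then have ij: "i < n" "j < n" by auto
    have "(mat_adjoint W * W) $$ (i, j) = (\<Sum>k<n. cnj (r i * ws ! i $ k) * (r j * ws ! j $ k))"
      using ij by (simp add: W_def scalar_prod_def atLeast0LessThan)
    also have "\<dots> = r i * (r j * (ws ! j \<bullet>c ws ! i))"
      using ij by (simp add: scalar_prod_def cnj_r dim_ws sum_distrib_left atLeast0LessThan mult_ac)
    also have "\<dots> = 1\<^sub>m n $$ (i, j)"
      using corthogonalD[OF ws(2), of j i] ij ws(3) r[of i] by auto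
    finally show "(mat_adjoint W * W) $$ (i, j) = 1\<^sub>m n $$ (i, j)" .
  qed (use W in auto)
  moreover have "ws ! 0 = v" using hdws ws(3) n by (cases ws) auto
  then have "col W 0 = r 0 \<cdot>\<^sub>v v"
    using n v by (intro eq_vecI) (auto simp: W_def)
  ultimately show ?thesis using W by blast
qed

text \<open>Deflation by induction on the list of roots: a unit eigenvector becomes the first basis
  vector and the rest is a smaller Hermitian block. The diagonal keeps the order of
  \<open>es\<close>, which later places the two possibly nonzero eigenvalues in front.\<close>

lemma hermitian_unitary_diagonalization:
  fixes H :: "complex mat"
  assumes "H \<in> carrier_mat n n" "mat_adjoint H = H" "char_poly H = (\<Prod>a\<leftarrow>es. [:- a, 1:])"
  shows "\<exists>U \<in> carrier_mat n n. mat_adjoint U * U = 1\<^sub>m n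
    \<and> mat_adjoint U * H * U = mat n n (\<lambda>(i, j). if i = j then es ! i else 0)"
  using assms
proof (induction es arbitrary: n H)
  case Nil
  then have "n = 0" using degree_monic_char_poly[of H n] by simp
  with Nil(1) show ?case by (intro bexI[of _ "1\<^sub>m n"]) auto
next
  case (Cons e es)
  note H = Cons.prems(1) and herm = Cons.prems(2) and cp = Cons.prems(3)
  have root: "poly (char_poly H) e = 0" unfolding cp by simp
  have "n \<noteq> 0"
  proof
    assume "n = 0"
    then obtain c where "char_poly H = [:c:]" "c = 1"
      using degree_monic_char_poly[OF H] by (metis coeff_pCons_0 degree_eq_zeroE)
    with root show False by simp
  qed
  then obtain m where n: "n = Suc m"
    by (cases n) auto
  have "eigenvalue H e"
    unfolding eigenvalue_root_char_poly[OF H] by (rule root)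
  then obtain v where v: "v \<in> carrier_vec n" "v \<noteq> 0\<^sub>v n" "H *\<^sub>v v = e \<cdot>\<^sub>v v"
    using H unfolding eigenvalue_def eigenvector_def by auto
  from ex_unitary_first_col[OF v(1,2)] obtain W c where
    W: "W \<in> carrier_mat n n" "mat_adjoint W * W = 1\<^sub>m n" "col W 0 = c \<cdot>\<^sub>v v" by blast
  define W' where "W' = mat_adjoint W"
  have W': "W' \<in> carrier_mat n n" using W by (simp add: W'_def)
  have WW': "W * W' = 1\<^sub>m n"
    using mat_mult_left_right_inverse[OF W' W(1)] W(2) by (simp add: W'_def)
  define G where "G = W' * H * W"
  have G: "G \<in> carrier_mat n n" unfolding G_def using W W' H by auto
  have Gherm: "mat_adjoint G = G"
    unfolding G_def W'_def by (rule hermitian_conjugate[OF H herm W(1)])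
  have "similar_mat_wit G H W' W"
    by (rule similar_mat_witI[of _ _ n]) (use W(1,2) W' H G WW' in \<open>simp_all add: G_def W'_def\<close>)
  then have cpG: "char_poly G = (\<Prod>a\<leftarrow>e # es. [:- a, 1:])"
    unfolding cp[symmetric] by (intro char_poly_similar) (auto simp only: similar_mat_def)
  \<comment> \<open>The first column of \<open>W\<close> is again an eigenvector for
    \<open>e\<close>, and \<open>W'\<close>, the inverse of \<open>W\<close>, sends it to the first
    unit vector.\<close>
  have "col G 0 = W' *\<^sub>v (H *\<^sub>v col W 0)"
  proof -
    have "col W 0 \<in> carrier_vec n" using W(1) by (intro carrier_vecI) simp
    with W(1) W' H n show ?thesis
      unfolding G_def col_mult2[OF mult_carrier_mat[OF W' H] W(1), of 0, unfolded n, OF zero_less_Suc]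
      by (intro assoc_mult_mat_vec) auto
  qed
  also have "H *\<^sub>v col W 0 = e \<cdot>\<^sub>v col W 0"
    unfolding W(3) mult_mat_vec[OF H v(1)] v(3) by (simp add: smult_smult_assoc mult.commute)
  also have "W' *\<^sub>v (e \<cdot>\<^sub>v col W 0) = e \<cdot>\<^sub>v col (W' * W) 0"
    using col_mult2[OF W' W(1), of 0] mult_mat_vec[OF W' carrier_vecI, of "col W 0"] W(1) n by simp
  also have "W' * W = 1\<^sub>m n" using W by (simp add: W'_def)
  finally have colG: "col G 0 = e \<cdot>\<^sub>v unit_vec n 0" using n by simp
  have G_i0: "G $$ (i, 0) = (if i = 0 then e else 0)" if "i < n" for i
    using arg_cong[OF colG, of "\<lambda>v. v $ i"] that G n by simp
  \<comment> \<open>Here the Hermitian hypothesis does its work: the cleared first column also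
    clears the first row, so \<open>G\<close> is block diagonal and not merely block
    triangular.\<close>
  have G_0i: "G $$ (0, i) = (if i = 0 then e else 0)" if "i < n" for i
  proof (cases "i = 0")
    case False
    have "G $$ (0, i) = cnj (G $$ (i, 0))"
      using mat_adjoint_index[of 0 G i] G that n Gherm by simp
    then show ?thesis using G_i0[OF that] False by simp
  qed (use G_i0 that in simp)
  define K where "K = mat m m (\<lambda>(i, j). G $$ (Suc i, Suc j))"
  have K: "K \<in> carrier_mat m m" by (simp add: K_def)
  have Kherm: "mat_adjoint K = K"
  proof (rule eq_matI)
    fix i j assume "i < dim_row K" "j < dim_col K"
    then show "mat_adjoint K $$ (i, j) = K $$ (i, j)"
      using mat_adjoint_index[of "Suc i" G "Suc j"] G n Gherm by (simp add: K_def)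
  qed (simp_all add: K_def)
  define E where "E = mat 1 1 (\<lambda>_. e)"
  have E: "E \<in> carrier_mat 1 1" by (simp add: E_def)
  have GK: "G = four_block_mat E (0\<^sub>m 1 m) (0\<^sub>m m 1) K"
    by (rule eq_matI) (use G n G_i0 G_0i in \<open>auto simp: K_def E_def\<close>)
  have "char_poly G = char_poly E * char_poly K"
    unfolding GK by (rule char_poly_four_block_zeros_col) (use E K in auto)
  moreover have "char_poly E = [:- e, 1:]"
    by (simp add: E_def char_poly_defs det_def sign_def)
  ultimately have "char_poly K = (\<Prod>a\<leftarrow>es. [:- a, 1:])"
    unfolding cpG list.map prod_list.Cons by (metis mult_cancel_left pCons_eq_0_iff zero_neq_one)
  from Cons.IH[OF K Kherm this] obtain V where V: "V \<in> carrier_mat m m"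
    "mat_adjoint V * V = 1\<^sub>m m"
    "mat_adjoint V * K * V = mat m m (\<lambda>(i, j). if i = j then es ! i else 0)" by blast
  have V': "mat_adjoint V \<in> carrier_mat m m" using V(1) by simp
  define X where "X = four_block_mat (1\<^sub>m 1) (0\<^sub>m 1 m) (0\<^sub>m m 1) V"
  have X: "X \<in> carrier_mat n n" unfolding X_def n using V by (auto intro!: four_block_carrier_mat)
  have z: "mat_adjoint (0\<^sub>m a b) = (0\<^sub>m b a :: complex mat)" for a b
    by (rule eq_matI) auto
  have o: "mat_adjoint (1\<^sub>m a) = (1\<^sub>m a :: complex mat)" for a
    by (rule eq_matI) auto
  define X' where "X' = mat_adjoint X"
  have X': "X' = four_block_mat (1\<^sub>m 1) (0\<^sub>m 1 m) (0\<^sub>m m 1) (mat_adjoint V)"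
    unfolding X'_def X_def using V by (simp add: four_block_mat_adjoint[of _ 1 _ m] z o)
  have X'_carr: "X' \<in> carrier_mat n n" using X by (simp add: X'_def)
  have X'X: "X' * X = 1\<^sub>m n"
    unfolding X' X_def n block_diag_mult[OF one_carrier_mat one_carrier_mat V' V(1)] V(2) by simp
  have D: "X' * G * X = mat n n (\<lambda>(i, j). if i = j then (e # es) ! i else 0)"
  proof -
    have "X' * G = four_block_mat E (0\<^sub>m 1 m) (0\<^sub>m m 1) (mat_adjoint V * K)"
      unfolding X' GK block_diag_mult[OF one_carrier_mat E V' K] using E by simp
    then have "X' * G * X = four_block_mat E (0\<^sub>m 1 m) (0\<^sub>m m 1) (mat_adjoint V * K * V)"
      unfolding X_def using block_diag_mult[OF E one_carrier_mat mult_carrier_mat[OF V' K] V(1)] E by simp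
    also have "\<dots> = mat n n (\<lambda>(i, j). if i = j then (e # es) ! i else 0)"
      unfolding V(3) n E_def by (rule eq_matI) (auto simp: nth_Cons')
    finally show ?thesis .
  qed
  show ?case
  proof (intro bexI conjI)
    show "W * X \<in> carrier_mat n n" using W X by auto
    have adj: "mat_adjoint (W * X) = X' * W'"
      unfolding X'_def W'_def by (rule mat_adjoint_mult[OF W(1) X])
    have "mat_adjoint (W * X) * (W * X) = X' * (W' * W) * X"
      unfolding adj using W(1) W' X X'_carr by (simp add: assoc_mult_mat[of _ n n _ n _ n])
    then show "mat_adjoint (W * X) * (W * X) = 1\<^sub>m n"
      using W(2) X'X X X'_carr by (simp add: W'_def)
    have "mat_adjoint (W * X) * H * (W * X) = X' * G * X"
      unfolding adj G_def using W(1) W' X X'_carr H by (simp add: assoc_mult_mat[of _ n n _ n _ n])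
    then show "mat_adjoint (W * X) * H * (W * X)
        = mat n n (\<lambda>(i, j). if i = j then (e # es) ! i else 0)" using D by simp
  qed
qed

section \<open>Semidefinite forms, rank and sums of squares\<close>

lemma quad_form_eq_sum:
  fixes N :: "real mat"
  assumes N: "N \<in> carrier_mat n n" and x: "x \<in> carrier_vec n" and y: "y \<in> carrier_vec n"
  shows "x \<bullet> (N *\<^sub>v y) = (\<Sum>i<n. \<Sum>j<n. x $ i * N $$ (i, j) * y $ j)"
  using assms by (auto simp: scalar_prod_def atLeast0LessThan sum_distrib_left mult.assoc intro!: sum.cong)

lemma rank_zero_imp_entries_zero:
  fixes N :: "real mat"
  assumes N: "N \<in> carrier_mat n n" and r: "vec_space.rank n N = 0" and i: "i < n" "j < n"
  shows "N $$ (i, j) = 0"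
proof (rule ccontr)
  interpret vec_space "TYPE(real)" n .
  assume "N $$ (i, j) \<noteq> 0"
  then have "col N j $ i \<noteq> 0" using N i by simp
  then have nz: "col N j \<noteq> 0\<^sub>v n" using i by auto
  have c: "col N j \<in> carrier_vec n" using N i by auto
  have "lin_indpt {col N j}"
    using lin_dep_iff_in_span[of "{}" "col N j"] nz c span_empty
    by (auto simp: lin_dep_def)
  moreover have "{col N j} \<subseteq> set (cols N)" using N i by (auto simp: cols_def)
  ultimately show False using rank_ge_card_indpt[OF N, of "{col N j}"] r by simp
qed

text \<open>All columns of \<open>N'\<close> lie in the column space of \<open>N\<close> and vanish
  in coordinate \<open>p\<close>, whereas \<open>col N p\<close> does not. Hence a maximal
  independent set of columns of \<open>N'\<close> can be enlarged by \<open>col N p\<close> inside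
  the column space of \<open>N\<close>.\<close>

lemma rank_pivot_elimination:
  fixes N N' :: "real mat"
  assumes N: "N \<in> carrier_mat n n" and N': "N' \<in> carrier_mat n n" and p: "p < n"
    and col: "\<And>j. j < n \<Longrightarrow> col N' j = col N j + c j \<cdot>\<^sub>v col N p"
    and row: "\<And>j. j < n \<Longrightarrow> N' $$ (p, j) = 0" and piv: "N $$ (p, p) \<noteq> 0"
  shows "Suc (vec_space.rank n N') \<le> vec_space.rank n N"
proof -
  interpret vec_space "TYPE(real)" n .
  obtain S where S: "maximal S (\<lambda>T. T \<subseteq> set (cols N') \<and> lin_indpt T)"
    using maximal_exists_superset[of "set (cols N')" "\<lambda>T. T \<subseteq> set (cols N') \<and> lin_indpt T" "{}"]
    by (auto simp: lin_dep_def)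
  then have rN': "rank N' = card S" by (rule rank_card_indpt[OF N'])
  have SN': "S \<subseteq> set (cols N')" and ind: "lin_indpt S" using S by (auto simp: maximal_def)
  have colsN: "set (cols N) \<subseteq> carrier_vec n" using N cols_dim by blast
  have Sc: "S \<subseteq> carrier_vec n" using SN' N' cols_dim by blast
  have fin: "finite S" using SN' finite_subset by blast
  have S0: "s $ p = 0" if "s \<in> S" for s
    using that SN' N' row p by (auto simp: cols_def)
  define u where "u = col N p"
  have u: "u \<in> carrier_vec n" using N p by (auto simp: u_def)
  have up: "u $ p \<noteq> 0" using piv N p by (simp add: u_def)
  have notin: "u \<notin> span S"
  proof
    assume "u \<in> span S"
    then obtain a where "u = lincomb a S"
      using finite_in_span[OF fin] Sc by auto
    then have "u $ p = (\<Sum>s\<in>S. a s * s $ p)" using lincomb_index[OF p Sc] by simp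
    also have "\<dots> = 0" using S0 by simp
    finally show False using up by simp
  qed
  then have uS: "u \<notin> S" using up S0 by auto
  have ind': "lin_indpt (S \<union> {u})"
    using lin_dep_iff_in_span[OF _ ind _ uS] notin Sc u by simp
  let ?V = "span (set (cols N))"
  have uV: "u \<in> ?V" using N p colsN by (intro span_mem) (auto simp: u_def cols_def)
  have "S \<subseteq> ?V"
  proof
    fix s assume "s \<in> S"
    then obtain j where j: "j < n" "s = col N' j" using SN' N' by (auto simp: cols_def)
    have "col N j \<in> ?V" using N j colsN by (intro span_mem) (auto simp: cols_def)
    moreover have "c j \<cdot>\<^sub>v u \<in> ?V"
      using submodule.smult_closed[OF span_is_submodule[OF colsN]] uV by simp
    ultimately show "s \<in> ?V" unfolding j(2) col[OF j(1)] u_def[symmetric]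
      using span_add1[OF colsN] by simp
  qed
  with uV have sub: "S \<union> {u} \<subseteq> ?V" by auto
  have vs: "vectorspace class_ring (span_vs (set (cols N)))"
    using span_is_subspace[THEN subspace_is_vs, OF colsN] by simp
  have "card (S \<union> {u}) \<le> rank N"
    unfolding rank_def
  proof (rule vectorspace.li_le_dim(2)[OF vs])
    show "vectorspace.fin_dim class_ring (span_vs (set (cols N)))"
      using fin_dim_span_cols[OF N] .
    show "S \<union> {u} \<subseteq> carrier (span_vs (set (cols N)))" using sub by simp
    show "LinearCombinations.module.lin_indpt class_ring (span_vs (set (cols N))) (S \<union> {u})"
      using span_li_not_depend(2)[OF sub span_is_submodule[OF colsN]] ind' by simp
  qed
  then show ?thesis using rN' uS fin by simp
qed

text \<open>The rank hypothesis concerns a negative semidefinite matrix, while the squares are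
  extracted from its negative.\<close>

lemma rank_uminus_le:
  fixes M :: "'a :: field mat"
  assumes M: "M \<in> carrier_mat n nc"
  shows "vec_space.rank n (- M) \<le> vec_space.rank n M"
proof -
  interpret vec_space "TYPE('a)" n .
  have c: "set (cols M) \<subseteq> carrier_vec n" "set (cols (- M)) \<subseteq> carrier_vec n"
    using M cols_dim[of M] cols_dim[of "- M"] by auto
  have "set (cols (- M)) \<subseteq> span (set (cols M))"
  proof
    fix v assume "v \<in> set (cols (- M))"
    then obtain j where j: "j < nc" "v = col (- M) j" using M by (auto simp: cols_def)
    then have "v = (- 1) \<cdot>\<^sub>v col M j" using M by (intro eq_vecI) auto
    moreover have "col M j \<in> span (set (cols M))"
      using M j c by (intro span_mem) (auto simp: cols_def)
    ultimately show "v \<in> span (set (cols M))"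
      using submodule.smult_closed[OF span_is_submodule[OF c(1)], of "- 1" "col M j"] by simp
  qed
  then have sub: "span (set (cols (- M))) \<subseteq> span (set (cols M))"
    using span_is_subset span_is_submodule[OF c(1)] by blast
  have s: "VectorSpace.subspace class_ring (span (set (cols (- M)))) V" "VectorSpace.subspace class_ring (span (set (cols M))) V"
    using span_is_subspace c by auto
  have uM: "- M \<in> carrier_mat n nc" using M by simp
  show ?thesis
    unfolding rank_def
    using vectorspace.subspace_dim[OF subspace_is_vs[OF s(2)] nested_subspaces[OF s(2,1) sub]
        fin_dim_span_cols[OF M]] fin_dim_span_cols[OF uM] by simp
qed

text \<open>At the sum and the difference of two unit vectors the form is at most plus or minus
  twice the mixed entry, so both signs of that entry are nonnegative. This serves two ends: it stops
  the pivoting when no positive diagonal entry is left, and it shows that a symmetric matrix with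
  vanishing form is zero.\<close>

lemma psd_diagonal_nonpos_imp_zero:
  fixes N :: "real mat"
  assumes N: "N \<in> carrier_mat n n" and sym: "\<And>i j. i < n \<Longrightarrow> j < n \<Longrightarrow> N $$ (i, j) = N $$ (j, i)"
    and psd: "\<And>x. x \<in> carrier_vec n \<Longrightarrow> x \<bullet> (N *\<^sub>v x) \<ge> 0"
    and diag: "\<And>i. i < n \<Longrightarrow> N $$ (i, i) \<le> 0" and ij: "i < n" "j < n"
  shows "N $$ (i, j) = 0"
proof -
  have e: "x \<bullet> (N *\<^sub>v x) = s * s * N $$ (i, i) + 2 * (s * t * N $$ (i, j)) + t * t * N $$ (j, j)"
    if "x = s \<cdot>\<^sub>v unit_vec n i + t \<cdot>\<^sub>v unit_vec n j" for x s t
  proof -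
    \<comment> \<open>The two Kronecker terms are kept separate, so that the formula also covers
      \<open>i = j\<close>.\<close>
    have *: "(\<Sum>k<n. (s * (if k = i then 1 else 0) + t * (if k = j then 1 else 0)) * f k) = s * f i + t * f j"
      for f :: "nat \<Rightarrow> real"
    proof -
      have "(\<Sum>k<n. (s * (if k = i then 1 else 0) + t * (if k = j then 1 else 0)) * f k)
          = (\<Sum>k<n. (if k = i then s * f k else 0) + (if k = j then t * f k else 0))"
        by (intro sum.cong refl) (auto simp: distrib_right)
      also have "\<dots> = s * f i + t * f j" using ij by (simp add: sum.distrib)
      finally show ?thesis .
    qed
    have "x \<bullet> (N *\<^sub>v x) = (\<Sum>k<n. \<Sum>l<n. x $ k * N $$ (k, l) * x $ l)"
      using that by (intro quad_form_eq_sum N) auto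
    also have "\<dots> = (\<Sum>k<n. (s * (if k = i then 1 else 0) + t * (if k = j then 1 else 0)) *
        (\<Sum>l<n. (s * (if l = i then 1 else 0) + t * (if l = j then 1 else 0)) * N $$ (k, l)))"
      unfolding that sum_distrib_left by (intro sum.cong refl) (auto simp: unit_vec_def)
    also have "\<dots> = s * (s * N $$ (i, i) + t * N $$ (i, j)) + t * (s * N $$ (j, i) + t * N $$ (j, j))"
      unfolding * ..
    finally show ?thesis using sym[OF ij] by (simp add: algebra_simps)
  qed
  have "N $$ (i, i) + 2 * (t * N $$ (i, j)) + t * t * N $$ (j, j) \<ge> 0" for t
    using psd[of "1 \<cdot>\<^sub>v unit_vec n i + t \<cdot>\<^sub>v unit_vec n j"] unfolding e[OF refl] by simp
  from this[of 1] this[of "- 1"] show ?thesis using diag[OF ij(1)] diag[OF ij(2)] by simp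
qed

lemma psd_sum_of_squares:
  fixes N :: "real mat"
  assumes "N \<in> carrier_mat n n" "\<And>i j. i < n \<Longrightarrow> j < n \<Longrightarrow> N $$ (i, j) = N $$ (j, i)"
    "\<And>x. x \<in> carrier_vec n \<Longrightarrow> x \<bullet> (N *\<^sub>v x) \<ge> 0" "vec_space.rank n N \<le> r"
  shows "\<exists>l. (\<forall>i. l i \<in> carrier_vec n)
    \<and> (\<forall>x \<in> carrier_vec n. x \<bullet> (N *\<^sub>v x) = (\<Sum>i<r. (l i \<bullet> x)\<^sup>2))"
  using assms
proof (induction r arbitrary: N)
  case 0
  then have "N $$ (i, j) = 0" if "i < n" "j < n" for i j
    using rank_zero_imp_entries_zero[of N n] that by simp
  then have "x \<bullet> (N *\<^sub>v x) = 0" if "x \<in> carrier_vec n" for x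
    using that quad_form_eq_sum[OF 0(1) that that] by simp
  then show ?case by (auto intro!: exI[of _ "\<lambda>_. 0\<^sub>v n"])
next
  case (Suc r)
  note N = Suc.prems(1) and sym = Suc.prems(2) and psd = Suc.prems(3) and rk = Suc.prems(4)
  show ?case
  proof (cases "\<forall>i<n. N $$ (i, i) \<le> 0")
    case True
    then have "N $$ (i, j) = 0" if "i < n" "j < n" for i j
      using psd_diagonal_nonpos_imp_zero[OF N sym psd _ that] by simp
    then have "x \<bullet> (N *\<^sub>v x) = (\<Sum>i<Suc r. (0\<^sub>v n \<bullet> x)\<^sup>2)" if "x \<in> carrier_vec n" for x
      using that quad_form_eq_sum[OF N that that] by simp
    then show ?thesis by (intro exI[of _ "\<lambda>_. 0\<^sub>v n"]) auto
  next
    case False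
    then obtain p where p: "p < n" "N $$ (p, p) > 0" by force
    define d where "d = N $$ (p, p)"
    \<comment> \<open>The Schur complement of the pivot. Scaling row \<open>p\<close> by
      \<open>1 / sqrt d\<close> makes the square of \<open>u\<close> exactly the form that is
      subtracted.\<close>
    define N' where "N' = mat n n (\<lambda>(i, j). N $$ (i, j) - N $$ (i, p) * N $$ (p, j) / d)"
    define u where "u = vec n (\<lambda>i. N $$ (p, i) / sqrt d)"
    have d: "d > 0" using p by (simp add: d_def)
    have N': "N' \<in> carrier_mat n n" by (simp add: N'_def)
    have u: "u \<in> carrier_vec n" by (simp add: u_def)
    have quad: "x \<bullet> (N' *\<^sub>v x) = x \<bullet> (N *\<^sub>v x) - (u \<bullet> x)\<^sup>2" if x: "x \<in> carrier_vec n" for x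
    proof -
      define g where "g = (\<Sum>j<n. N $$ (p, j) * x $ j)"
      have "u \<bullet> x = g / sqrt d"
        using x by (simp add: u_def g_def scalar_prod_def atLeast0LessThan sum_divide_distrib)
      then have "(u \<bullet> x)\<^sup>2 = g * g / d" using d by (simp add: power2_eq_square)
      moreover have "x \<bullet> (N' *\<^sub>v x) = x \<bullet> (N *\<^sub>v x) - g * g / d"
      proof -
        have "x \<bullet> (N' *\<^sub>v x) = (\<Sum>i<n. \<Sum>j<n. x $ i * N $$ (i, j) * x $ j
            - N $$ (p, i) * x $ i * (N $$ (p, j) * x $ j) / d)"
          unfolding quad_form_eq_sum[OF N' x x]
          using sym[of _ p] p(1) by (intro sum.cong refl) (simp add: N'_def field_simps)
        also have "\<dots> = x \<bullet> (N *\<^sub>v x) - g * g / d"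
          unfolding quad_form_eq_sum[OF N x x]
          by (simp add: sum_subtractf g_def sum_product sum_divide_distrib)
        finally show ?thesis .
      qed
      ultimately show ?thesis by simp
    qed
    have "\<exists>l. (\<forall>i. l i \<in> carrier_vec n) \<and> (\<forall>x \<in> carrier_vec n. x \<bullet> (N' *\<^sub>v x) = (\<Sum>i<r. (l i \<bullet> x)\<^sup>2))"
    proof (rule Suc.IH[OF N'])
      show "N' $$ (i, j) = N' $$ (j, i)" if "i < n" "j < n" for i j
        using that sym[of i p] sym[of j p] sym[of i j] p by (simp add: N'_def)
      show "x \<bullet> (N' *\<^sub>v x) \<ge> 0" if x: "x \<in> carrier_vec n" for x
      proof -
        \<comment> \<open>Evaluate the form of \<open>N\<close> at \<open>x - t e\<^sub>p\<close> with \<open>t\<close> chosen to minimise it.\<close>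
        define g where "g = (\<Sum>j<n. N $$ (p, j) * x $ j)"
        define y where "y = x - (g / d) \<cdot>\<^sub>v unit_vec n p"
        have y: "y \<in> carrier_vec n" using x by (simp add: y_def)
        have uy: "u \<bullet> y = 0"
        proof -
          have "u \<bullet> y = (\<Sum>j<n. N $$ (p, j) * x $ j / sqrt d - (if j = p then N $$ (p, j) * (g / d) / sqrt d else 0))"
            using x by (auto simp: y_def u_def scalar_prod_def atLeast0LessThan unit_vec_def algebra_simps
                diff_divide_distrib intro!: sum.cong)
          also have "\<dots> = g / sqrt d - N $$ (p, p) * (g / d) / sqrt d"
            using p(1) by (simp add: sum_subtractf g_def sum_divide_distrib)
          also have "\<dots> = 0" using d by (simp add: d_def)
          finally show ?thesis .
        qed
        \<comment> \<open>Row and column \<open>p\<close> of \<open>N'\<close> vanish, so its form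
          ignores the only coordinate in which \<open>y\<close> and \<open>x\<close> differ.\<close>
        have "y \<bullet> (N' *\<^sub>v y) = x \<bullet> (N' *\<^sub>v x)"
        proof -
          have z: "N' $$ (p, j) = 0" "N' $$ (j, p) = 0" if "j < n" for j
            using that p d by (simp_all add: N'_def d_def)
          have "y $ i * N' $$ (i, j) * y $ j = x $ i * N' $$ (i, j) * x $ j" if "i < n" "j < n" for i j
            using that z x by (auto simp: y_def unit_vec_def)
          then show ?thesis
            unfolding quad_form_eq_sum[OF N' x x] quad_form_eq_sum[OF N' y y]
            by (intro sum.cong refl) auto
        qed
        then show ?thesis using quad[OF y] psd[OF y] uy by simp
      qed
      have "Suc (vec_space.rank n N') \<le> vec_space.rank n N"
      proof (rule rank_pivot_elimination[OF N N' p(1)])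
        show "col N' j = col N j + (- N $$ (p, j) / d) \<cdot>\<^sub>v col N p" if "j < n" for j
          using that N p by (intro eq_vecI) (auto simp: N'_def)
        show "N' $$ (p, j) = 0" if "j < n" for j
          using that p d by (simp add: N'_def d_def)
      qed (use p in simp)
      then show "vec_space.rank n N' \<le> r" using rk by simp
    qed
    then obtain l where l: "\<And>i. l i \<in> carrier_vec n"
      "\<And>x. x \<in> carrier_vec n \<Longrightarrow> x \<bullet> (N' *\<^sub>v x) = (\<Sum>i<r. (l i \<bullet> x)\<^sup>2)" by blast
    have "x \<bullet> (N *\<^sub>v x) = (\<Sum>i<Suc r. ((if i < r then l i else u) \<bullet> x)\<^sup>2)" if "x \<in> carrier_vec n" for x
      using quad[OF that] l(2)[OF that] by simp
    then show ?thesis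
      using l(1) u by (intro exI[of _ "\<lambda>i. if i < r then l i else u"]) auto
  qed
qed

text \<open>Each summand is a matrix of rank at most one, and rank is subadditive. The weights
  \<open>c\<close> admit the sign -1 of a negative semidefinite form.\<close>

lemma rank_sum_of_squares:
  fixes N :: "real mat"
  assumes N: "N \<in> carrier_mat n n"
    and ent: "\<And>i j. i < n \<Longrightarrow> j < n \<Longrightarrow> N $$ (i, j) = (\<Sum>k<r. c k * (l k $ i * l k $ j))"
  shows "vec_space.rank n N \<le> r"
  using assms
proof (induction r arbitrary: N)
  case 0
  then have "N = 0\<^sub>m n n" by (intro eq_matI) auto
  then show ?case using vec_space.rank_0I[of n n] by simp
next
  case (Suc r)
  define N1 where "N1 = mat n n (\<lambda>(i, j). \<Sum>k<r. c k * (l k $ i * l k $ j))"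
  define N2 where "N2 = mat n n (\<lambda>(i, j). c r * (l r $ i * l r $ j))"
  have c: "N1 \<in> carrier_mat n n" "N2 \<in> carrier_mat n n" by (auto simp: N1_def N2_def)
  have "N = N1 + N2"
    by (rule eq_matI) (use Suc.prems in \<open>auto simp: N1_def N2_def\<close>)
  moreover have "vec_space.rank n N1 \<le> r"
    by (rule Suc.IH) (auto simp: N1_def)
  moreover have "vec_space.rank n N2 \<le> 1"
    by (rule vec_space.rank_le_1_product_entries[OF c(2), of "\<lambda>i. c r * l r $ i" "\<lambda>j. l r $ j"])
       (auto simp: N2_def)
  ultimately show ?case
    using vec_space.rank_subadditive[OF c] by simp
qed

section \<open>Pencils of size two and bordered identities\<close>

lemma det_2x2:
  fixes M :: "'a :: idom mat"
  assumes "M \<in> carrier_mat 2 2"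
  shows "det M = M $$ (0, 0) * M $$ (1, 1) - M $$ (0, 1) * M $$ (1, 0)"
proof -
  let ?e = "\<lambda>i j. mat 1 1 (\<lambda>_. M $$ (i, j))"
  have eq: "M = four_block_mat (?e 0 0) (?e 0 1) (?e 1 0) (?e 1 1)"
    by (rule eq_matI) (use assms in \<open>auto simp: less_Suc_eq numeral_2_eq_2\<close>)
  have "det (four_block_mat (?e 0 0) (?e 0 1) (?e 1 0) (?e 1 1))
      = det (?e 0 0 * ?e 1 1 - ?e 0 1 * ?e 1 0)"
    by (rule det_four_block_mat[of _ 1]) (auto intro!: eq_matI simp: scalar_prod_def mult.commute)
  also have "\<dots> = M $$ (0, 0) * M $$ (1, 1) - M $$ (0, 1) * M $$ (1, 0)"
    by (subst det_single) (auto simp: scalar_prod_def)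
  finally show ?thesis using eq by simp
qed

text \<open>Right multiplication by the unit lower triangular \<open>Q\<close> clears the first
  column below the corner and leaves the Schur complement of the identity block in the corner. The
  border is not conjugated, as it will carry real linear forms.\<close>

lemma det_bordered_identity:
  fixes a :: "'a :: idom"
  shows "det (mat (Suc m) (Suc m) (\<lambda>(r, c). if r = 0 then if c = 0 then a else v (c - 1)
      else if c = 0 then v (r - 1) else if r = c then 1 else 0)) = a - (\<Sum>i<m. v i * v i)"
    (is "det ?P = _")
proof -
  define A B C where "A = mat 1 1 (\<lambda>_. a)" and "B = mat 1 m (\<lambda>(r, c). v c)" and "C = mat m 1 (\<lambda>(r, c). v r)"
  have carr: "A \<in> carrier_mat 1 1" "B \<in> carrier_mat 1 m" "C \<in> carrier_mat m 1" "- C \<in> carrier_mat m 1"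
    by (auto simp: A_def B_def C_def)
  define Q where "Q = four_block_mat (1\<^sub>m 1) (0\<^sub>m 1 m) (- C) (1\<^sub>m m)"
  have P: "?P = four_block_mat A B C (1\<^sub>m m)"
    by (rule eq_matI) (auto simp: A_def B_def C_def)
  have D: "A * 1\<^sub>m 1 + B * (- C) \<in> carrier_mat 1 1" using carr by auto
  have "?P * Q = four_block_mat (A * 1\<^sub>m 1 + B * (- C)) (A * 0\<^sub>m 1 m + B * 1\<^sub>m m)
      (C * 1\<^sub>m 1 + 1\<^sub>m m * (- C)) (C * 0\<^sub>m 1 m + 1\<^sub>m m * 1\<^sub>m m)"
    unfolding P Q_def by (rule mult_four_block_mat) (use carr in auto)
  also have "C * 1\<^sub>m 1 + 1\<^sub>m m * (- C) = 0\<^sub>m m 1"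
    unfolding right_mult_one_mat[OF carr(3)] left_mult_one_mat[OF carr(4)]
    by (rule eq_matI) (use carr in auto)
  also have "C * 0\<^sub>m 1 m + 1\<^sub>m m * 1\<^sub>m m = 1\<^sub>m m"
    using carr by (simp add: right_mult_zero_mat[OF carr(3)])
  also have "det (four_block_mat (A * 1\<^sub>m 1 + B * (- C)) (A * 0\<^sub>m 1 m + B * 1\<^sub>m m) (0\<^sub>m m 1) (1\<^sub>m m))
      = det (A * 1\<^sub>m 1 + B * (- C)) * det (1\<^sub>m m)"
    by (rule det_four_block_mat_lower_left_zero) (use carr in auto)
  also have "det (A * 1\<^sub>m 1 + B * (- C)) = a - (\<Sum>i<m. v i * v i)"
    using D by (subst det_single)
      (auto simp: A_def B_def C_def scalar_prod_def atLeast0LessThan sum_negf)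
  finally have "det (?P * Q) = a - (\<Sum>i<m. v i * v i)" by simp
  moreover have "det Q = det (1\<^sub>m 1) * det (1\<^sub>m m)"
    unfolding Q_def by (rule det_four_block_mat_upper_right_zero) (use carr in auto)
  moreover have "det (?P * Q) = det ?P * det Q"
    by (rule det_mult[of _ "Suc m"]) (auto simp: Q_def)
  ultimately show ?thesis by simp
qed

section \<open>Pencils whose determinants are differences of squares\<close>

lemma pencil_carrier [simp]: "pencil n k As x \<in> carrier_mat k k"
  by (simp add: pencil_def)

lemma pencil_dim [simp]: "dim_row (pencil n k As x) = k" "dim_col (pencil n k As x) = k"
  by (simp_all add: pencil_def)

lemma pencil_index:
  assumes "r < k" "c < k"
  shows "pencil n k As x $$ (r, c) = (if r = c then 1 else 0) + (\<Sum>j<n. complex_of_real (x $ j) * As j $$ (r, c))"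
  using assms by (simp add: pencil_def)

lemma hermitian_matI:
  assumes "M \<in> carrier_mat k k" "\<And>r c. r < k \<Longrightarrow> c < k \<Longrightarrow> M $$ (r, c) = cnj (M $$ (c, r))"
  shows "hermitian_mat M"
proof -
  have "mat_adjoint M = M"
  proof (rule eq_matI)
    fix r c assume "r < dim_row M" "c < dim_col M"
    then have rc: "r < k" "c < k" using assms(1) by auto
    show "mat_adjoint M $$ (r, c) = M $$ (r, c)"
      using rc assms(1) by (subst assms(2)[OF rc]) simp
  qed (use assms(1) in auto)
  then show ?thesis using assms(1) by (simp add: hermitian_mat_def)
qed

lemma hermitian_mat_index:
  assumes "hermitian_mat M" "M \<in> carrier_mat k k" "r < k" "c < k"
  shows "M $$ (r, c) = cnj (M $$ (c, r))"
proof -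
  have "mat_adjoint M $$ (r, c) = cnj (M $$ (c, r))"
    using assms by (intro mat_adjoint_index) auto
  then show ?thesis using assms(1) by (simp add: hermitian_mat_def)
qed

lemma scalar_prod_eq_sum:
  fixes u v :: "'a :: comm_semiring_0 vec"
  assumes "u \<in> carrier_vec n" "v \<in> carrier_vec n"
  shows "u \<bullet> v = (\<Sum>j<n. v $ j * u $ j)"
  using assms by (simp add: scalar_prod_def atLeast0LessThan mult.commute)

lemma of_real_scalar_prod:
  assumes "u \<in> carrier_vec n" "v \<in> carrier_vec n"
  shows "(\<Sum>j<n. complex_of_real (v $ j) * complex_of_real (u $ j)) = complex_of_real (u \<bullet> v)"
  unfolding scalar_prod_eq_sum[OF assms] by simp

lemma mhdr_of_affine_minus_squares:
  assumes b: "b \<in> carrier_vec n" and l: "\<And>i. l i \<in> carrier_vec n"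
    and f: "\<And>x. x \<in> carrier_vec n \<Longrightarrow> f x = 1 + b \<bullet> x - (\<Sum>i<m. (l i \<bullet> x)\<^sup>2)"
  shows "has_mhdr n f (Suc m)"
proof -
  \<comment> \<open>Border position \<open>r\<close> carries the form with index
    \<open>r - 1\<close>. The ones on the lower diagonal belong to the constant term of the pencil,
    so the coefficients vanish there.\<close>
  define As where "As j = mat (Suc m) (Suc m) (\<lambda>(r, c). complex_of_real
      (if r = 0 then if c = 0 then b $ j else l (c - 1) $ j else if c = 0 then l (r - 1) $ j else 0))" for j
  show ?thesis
    unfolding has_mhdr_def
  proof (intro exI[of _ As] conjI allI impI ballI)
    fix j
    show "As j \<in> carrier_mat (Suc m) (Suc m)" by (simp add: As_def)
    then show "hermitian_mat (As j)" by (rule hermitian_matI) (auto simp: As_def)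
  next
    fix x :: "real vec" assume x: "x \<in> carrier_vec n"
    have P: "pencil n (Suc m) As x = mat (Suc m) (Suc m) (\<lambda>(r, c).
        if r = 0 then if c = 0 then complex_of_real (1 + b \<bullet> x) else complex_of_real (l (c - 1) \<bullet> x)
        else if c = 0 then complex_of_real (l (r - 1) \<bullet> x) else if r = c then 1 else 0)"
      by (rule eq_matI) (auto simp: pencil_index As_def of_real_scalar_prod[OF _ x] b l)
    show "complex_of_real (f x) = det (pencil n (Suc m) As x)"
      unfolding P det_bordered_identity[where v = "\<lambda>i. complex_of_real (l i \<bullet> x)"] f[OF x]
      by (simp add: power2_eq_square)
  qed
qed

lemma mhdr_of_square_minus_three_squares:
  assumes b: "b \<in> carrier_vec n" and l: "\<And>i. l i \<in> carrier_vec n"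
    and f: "\<And>x. x \<in> carrier_vec n \<Longrightarrow> f x = (1 + (b \<bullet> x) / 2)\<^sup>2 - (\<Sum>i<3::nat. (l i \<bullet> x)\<^sup>2)"
  shows "has_mhdr n f 2"
proof -
  \<comment> \<open>\<open>l 0\<close> separates the two diagonal entries, while \<open>l 1\<close>
    and \<open>l 2\<close> are the real and imaginary parts of the off-diagonal entry, whose squared
    modulus supplies two squares.\<close>
  define As where "As j = mat 2 2 (\<lambda>(r, c).
      if r = c then complex_of_real (b $ j / 2 + (if r = 0 then l 0 $ j else - l 0 $ j))
      else if r = 0 then Complex (l 1 $ j) (l 2 $ j) else Complex (l 1 $ j) (- l 2 $ j))" for j
  show ?thesis
    unfolding has_mhdr_def
  proof (intro exI[of _ As] conjI allI impI ballI)
    fix j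
    show "As j \<in> carrier_mat 2 2" by (simp add: As_def)
    then show "hermitian_mat (As j)" by (rule hermitian_matI) (auto simp: As_def complex_eq_iff)
  next
    fix x :: "real vec" assume x: "x \<in> carrier_vec n"
    let ?P = "pencil n 2 As x"
    note s = scalar_prod_eq_sum[OF b x] scalar_prod_eq_sum[OF l x]
    have P: "?P $$ (0, 0) = complex_of_real (1 + (b \<bullet> x) / 2 + l 0 \<bullet> x)"
      "?P $$ (1, 1) = complex_of_real (1 + (b \<bullet> x) / 2 - l 0 \<bullet> x)"
      "?P $$ (0, 1) = Complex (l 1 \<bullet> x) (l 2 \<bullet> x)"
      "?P $$ (1, 0) = Complex (l 1 \<bullet> x) (- (l 2 \<bullet> x))"
      by (simp_all add: pencil_index As_def s complex_eq_iff Re_sum Im_sum sum.distrib sum_subtractf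
          sum_negf sum_divide_distrib distrib_left right_diff_distrib)
    have "f x = (1 + (b \<bullet> x) / 2)\<^sup>2 - ((l 0 \<bullet> x)\<^sup>2 + (l 1 \<bullet> x)\<^sup>2 + (l 2 \<bullet> x)\<^sup>2)"
      unfolding f[OF x] by (simp add: eval_nat_numeral)
    then show "complex_of_real (f x) = det ?P"
      unfolding det_2x2[OF pencil_carrier] P
      by (simp only:) (simp add: complex_eq_iff power2_eq_square algebra_simps)
  qed
qed

text \<open>On a line through the origin the homogeneous parts of \<open>f\<close> are told apart by
  powers of \<open>t\<close>, which is how linear and quadratic parts are compared below.\<close>

lemma quad_poly_scale:
  assumes A: "A \<in> carrier_mat n n" and b: "b \<in> carrier_vec n" and x: "x \<in> carrier_vec n"
  shows "quad_poly A b (t \<cdot>\<^sub>v x) = 1 + t * (b \<bullet> x) + t\<^sup>2 * (x \<bullet> (A *\<^sub>v x))"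
proof -
  have "A *\<^sub>v x \<in> carrier_vec n" using A x by simp
  then show ?thesis
    using A b x by (simp add: quad_poly_def mult_mat_vec[OF A x] power2_eq_square)
qed

lemma shifted_quad_form:
  assumes A: "A \<in> carrier_mat n n" and b: "b \<in> carrier_vec n" and x: "x \<in> carrier_vec n"
  shows "x \<bullet> ((A - (1/4) \<cdot>\<^sub>m outer_prod b) *\<^sub>v x) = x \<bullet> (A *\<^sub>v x) - (b \<bullet> x)\<^sup>2 / 4"
proof -
  let ?M = "A - (1/4) \<cdot>\<^sub>m outer_prod b"
  have M: "?M \<in> carrier_mat n n" using A b by (auto simp: outer_prod_def)
  have "x \<bullet> (?M *\<^sub>v x) = (\<Sum>i<n. \<Sum>j<n. x $ i * A $$ (i, j) * x $ j - x $ i * b $ i * (x $ j * b $ j) / 4)"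
    unfolding quad_form_eq_sum[OF M x x]
    using A b by (intro sum.cong refl) (simp add: outer_prod_def field_simps)
  also have "\<dots> = x \<bullet> (A *\<^sub>v x) - (b \<bullet> x)\<^sup>2 / 4"
    unfolding quad_form_eq_sum[OF A x x] scalar_prod_eq_sum[OF b x]
    by (simp add: sum_subtractf power2_eq_square sum_product sum_divide_distrib)
  finally show ?thesis .
qed

lemma symmetric_mat_index:
  assumes "A \<in> carrier_mat n n" "A\<^sup>T = A" "i < n" "j < n"
  shows "A $$ (i, j) = A $$ (j, i)"
  using assms index_transpose_mat(1)[of i A j] by (metis carrier_matD)

lemma shifted_mat_index:
  assumes "A \<in> carrier_mat n n" "A\<^sup>T = A" "b \<in> carrier_vec n" "i < n" "j < n"
  shows "(A - (1/4) \<cdot>\<^sub>m outer_prod b) $$ (i, j) = A $$ (i, j) - b $ i * b $ j / 4"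
  using assms by (simp add: outer_prod_def)

text \<open>Reading the Pauli coordinates off the coefficients writes \<open>f\<close> as a square
  minus three squares. Comparing linear parts forces \<open>m\<close> to be half of
  \<open>b\<close>, so the form of \<open>M\<close> is minus the three squares; the rank bound then
  needs this as an identity of matrices, not only of forms.\<close>

lemma mhdr_2_imp_rank_le_3:
  assumes A: "A \<in> carrier_mat n n" "A\<^sup>T = A" and b: "b \<in> carrier_vec n"
    and rep: "has_mhdr n (quad_poly A b) 2"
  defines "M \<equiv> A - (1/4) \<cdot>\<^sub>m outer_prod b"
  shows "neg_semidef n M \<and> vec_space.rank n M \<le> 3"
proof -
  from rep obtain As where As: "\<And>j. j < n \<Longrightarrow> As j \<in> carrier_mat 2 2" "\<And>j. j < n \<Longrightarrow> hermitian_mat (As j)"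
    and det: "\<And>x. x \<in> carrier_vec n \<Longrightarrow> complex_of_real (quad_poly A b x) = det (pencil n 2 As x)"
    unfolding has_mhdr_def by blast
  have M: "M \<in> carrier_mat n n" using A b by (auto simp: M_def outer_prod_def)
  define l where "l k = vec n (\<lambda>j. if k = 0 then (Re (As j $$ (0, 0)) - Re (As j $$ (1, 1))) / 2
    else if k = 1 then Re (As j $$ (0, 1)) else Im (As j $$ (0, 1)))" for k :: nat
  define m where "m = vec n (\<lambda>j. (Re (As j $$ (0, 0)) + Re (As j $$ (1, 1))) / 2)"
  have l: "l k \<in> carrier_vec n" for k by (simp add: l_def)
  have m: "m \<in> carrier_vec n" by (simp add: m_def)
  have As_01: "As j $$ (1, 0) = cnj (As j $$ (0, 1))" if "j < n" for j
    using hermitian_mat_index[OF As(2)[OF that] As(1)[OF that], of 1 0] by simp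
  have As_ii: "Im (As j $$ (i, i)) = 0" if "j < n" "i < 2" for i j
    using hermitian_mat_index[OF As(2)[OF that(1)] As(1)[OF that(1)] that(2) that(2)] by (simp add: complex_eq_iff)
  have eq: "quad_poly A b x = (1 + m \<bullet> x)\<^sup>2 - (\<Sum>k<3. (l k \<bullet> x)\<^sup>2)" if x: "x \<in> carrier_vec n" for x
  proof -
    let ?P = "pencil n 2 As x"
    note s = scalar_prod_eq_sum[OF m x] scalar_prod_eq_sum[OF l x]
    have P: "?P $$ (0, 0) = complex_of_real (1 + m \<bullet> x + l 0 \<bullet> x)"
      "?P $$ (1, 1) = complex_of_real (1 + m \<bullet> x - l 0 \<bullet> x)"
      "?P $$ (0, 1) = Complex (l 1 \<bullet> x) (l 2 \<bullet> x)"
      "?P $$ (1, 0) = Complex (l 1 \<bullet> x) (- (l 2 \<bullet> x))"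
      unfolding s
      by (simp_all add: pencil_index l_def m_def complex_eq_iff Re_sum Im_sum As_01[simplified] As_ii
          sum.distrib[symmetric] sum_subtractf[symmetric] sum_negf[symmetric] field_simps)
    have "complex_of_real (quad_poly A b x)
        = complex_of_real ((1 + m \<bullet> x)\<^sup>2 - ((l 0 \<bullet> x)\<^sup>2 + (l 1 \<bullet> x)\<^sup>2 + (l 2 \<bullet> x)\<^sup>2))"
      unfolding det[OF x] det_2x2[OF pencil_carrier] P
      by (simp add: complex_eq_iff power2_eq_square algebra_simps)
    then show ?thesis unfolding of_real_eq_iff by (simp add: eval_nat_numeral)
  qed
  have quad: "x \<bullet> (M *\<^sub>v x) = - (\<Sum>k<3. (l k \<bullet> x)\<^sup>2)" if x: "x \<in> carrier_vec n" for x
  proof -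
    have e: "1 + t * (b \<bullet> x) + t\<^sup>2 * (x \<bullet> (A *\<^sub>v x)) = (1 + t * (m \<bullet> x))\<^sup>2 - t\<^sup>2 * (\<Sum>k<3. (l k \<bullet> x)\<^sup>2)" for t
      using eq[of "t \<cdot>\<^sub>v x"] x m l unfolding quad_poly_scale[OF A(1) b x]
      by (simp add: power_mult_distrib sum_distrib_left)
    \<comment> \<open>The difference of the instances \<open>t = 1\<close> and \<open>t = -1\<close>
      gives the linear part, their sum the quadratic part.\<close>
    have "b \<bullet> x = 2 * (m \<bullet> x)" "x \<bullet> (A *\<^sub>v x) = (m \<bullet> x)\<^sup>2 - (\<Sum>k<3. (l k \<bullet> x)\<^sup>2)"
      using e[of 1] e[of "- 1"] by (simp_all add: power2_eq_square algebra_simps)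
    then show ?thesis
      unfolding M_def shifted_quad_form[OF A(1) b x] by (simp add: power2_eq_square)
  qed
  \<comment> \<open>The defect between \<open>M\<close> and minus the sum of the outer products. Its
    form vanishes and it is symmetric, so it is zero.\<close>
  define E where "E = mat n n (\<lambda>(i, j). M $$ (i, j) + (\<Sum>k<3. l k $ i * l k $ j))"
  have E: "E \<in> carrier_mat n n" by (simp add: E_def)
  have E0: "x \<bullet> (E *\<^sub>v x) = 0" if x: "x \<in> carrier_vec n" for x
  proof -
    have "x \<bullet> (E *\<^sub>v x) = (\<Sum>i<n. \<Sum>j<n. x $ i * M $$ (i, j) * x $ j
        + (\<Sum>k<3. x $ i * l k $ i * (x $ j * l k $ j)))"
      unfolding quad_form_eq_sum[OF E x x]
      by (intro sum.cong refl) (simp add: E_def distrib_left distrib_right sum_distrib_left sum_distrib_right mult_ac)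
    also have "\<dots> = x \<bullet> (M *\<^sub>v x) + (\<Sum>i<n. \<Sum>j<n. \<Sum>k<3. x $ i * l k $ i * (x $ j * l k $ j))"
      unfolding quad_form_eq_sum[OF M x x] by (simp add: sum.distrib)
    also have "(\<Sum>i<n. \<Sum>j<n. \<Sum>k<3. x $ i * l k $ i * (x $ j * l k $ j))
        = (\<Sum>k<3. \<Sum>i<n. \<Sum>j<n. x $ i * l k $ i * (x $ j * l k $ j))"
      by (subst sum.swap[of _ "{..<3}"], subst sum.swap[of _ "{..<3}"]) simp
    also have "\<dots> = (\<Sum>k<3. (l k \<bullet> x)\<^sup>2)"
      unfolding scalar_prod_eq_sum[OF l x] power2_eq_square sum_product ..
    finally show ?thesis using quad[OF x] by simp
  qed
  have Msym: "M $$ (i, j) = M $$ (j, i)" if "i < n" "j < n" for i j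
    using that symmetric_mat_index[OF A that] unfolding M_def
    by (simp add: shifted_mat_index[OF A b])
  have Esym: "E $$ (i, j) = E $$ (j, i)" if "i < n" "j < n" for i j
    using that Msym[OF that] by (simp add: E_def mult.commute)
  have "E $$ (i, i) \<le> 0" if "i < n" for i
  proof -
    have "unit_vec n i \<bullet> (E *\<^sub>v unit_vec n i) = E $$ (i, i)"
      using that E by simp
    then show ?thesis using E0[of "unit_vec n i"] by simp
  qed
  then have "E $$ (i, j) = 0" if "i < n" "j < n" for i j
    using psd_diagonal_nonpos_imp_zero[OF E Esym _ _ that] E0 by simp
  then have "M $$ (i, j) = (\<Sum>k<3. (- 1) * (l k $ i * l k $ j))" if "i < n" "j < n" for i j
    using that by (simp add: E_def sum_negf eq_neg_iff_add_eq_0)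
  then have "vec_space.rank n M \<le> 3" by (rule rank_sum_of_squares[OF M])
  moreover have "neg_semidef n M"
    unfolding neg_semidef_def using M quad by (auto simp: sum_nonneg)
  ultimately show ?thesis by simp
qed

section \<open>Reduction to size two\<close>

text \<open>The characteristic polynomial is the reversal of \<open>det (1 + t H)\<close>: take
  \<open>t = -1/z\<close> and multiply by \<open>z^k\<close>. With \<open>t\<close> real, the two
  sides are known to agree at all positive real \<open>z\<close>, which is infinitely many points
  and hence enough.\<close>

lemma char_poly_of_det_quadratic:
  fixes H :: "complex mat"
  assumes H: "H \<in> carrier_mat k k" and k: "2 \<le> k"
    and det: "\<And>t :: real. det (1\<^sub>m k + complex_of_real t \<cdot>\<^sub>m H) = 1 + of_real t * \<beta> + (of_real t)\<^sup>2 * \<alpha>"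
  shows "char_poly H = [:\<alpha>, - \<beta>, 1:] * [:0, 1:] ^ (k - 2)"
proof (rule ccontr)
  define p where "p = char_poly H - [:\<alpha>, - \<beta>, 1:] * [:0, 1:] ^ (k - 2)"
  assume "\<not> ?thesis"
  then have "finite {z. poly p z = 0}" by (intro poly_roots_finite) (simp add: p_def)
  moreover have "complex_of_real ` {0<..} \<subseteq> {z. poly p z = 0}"
  proof clarify
    fix s :: real assume s: "s > 0"
    define z where "z = complex_of_real s"
    have z: "z \<noteq> 0" using s by (simp add: z_def)
    have "poly (char_poly H) z = det (- char_matrix H z)" by (rule char_poly_matrix[OF H])
    also have "- char_matrix H z = z \<cdot>\<^sub>m (1\<^sub>m k + complex_of_real (- 1 / s) \<cdot>\<^sub>m H)"
      by (rule eq_matI) (use H z in \<open>auto simp: char_matrix_def z_def distrib_left right_diff_distrib\<close>)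
    also have "det \<dots> = z ^ k * (1 - \<beta> / z + \<alpha> / z\<^sup>2)"
      unfolding det_smult det by (use H in \<open>simp add: z_def power2_eq_square\<close>)
    also have "\<dots> = z ^ (k - 2) * (z\<^sup>2 - \<beta> * z + \<alpha>)"
    proof -
      have "z ^ k = z ^ (k - 2) * z\<^sup>2" unfolding power_add[symmetric] le_add_diff_inverse2[OF k] ..
      then show ?thesis using z by (simp add: field_simps power2_eq_square)
    qed
    finally show "poly p (complex_of_real s) = 0"
      unfolding p_def z_def[symmetric] by (simp add: algebra_simps power2_eq_square)
  qed
  ultimately have "finite (complex_of_real ` {0<..})" by (rule rev_finite_subset)
  then have "finite {0::real<..}" by (rule finite_imageD) (simp add: inj_on_def)
  then show False using infinite_Ioi by blast
qed

lemma hermitian_diagonalization_det_quadratic: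
  fixes H :: "complex mat"
  assumes H: "H \<in> carrier_mat k k" "mat_adjoint H = H" and k: "2 \<le> k"
    and det: "\<And>t :: real. det (1\<^sub>m k + complex_of_real t \<cdot>\<^sub>m H) = 1 + of_real t * of_real \<beta> + (of_real t)\<^sup>2 * of_real \<alpha>"
  shows "\<exists>U d. U \<in> carrier_mat k k \<and> mat_adjoint U * U = 1\<^sub>m k
    \<and> mat_adjoint U * H * U = mat k k (\<lambda>(i, j). if i = j then complex_of_real (d i) else 0)
    \<and> (\<forall>i\<ge>2. d i = 0) \<and> d 0 + d 1 = \<beta> \<and> d 0 * d 1 = \<alpha>"
proof -
  define b :: complex where "b = of_real \<beta>"
  define a :: complex where "a = of_real \<alpha>"
  \<comment> \<open>The roots of \<open>z^2 - b z + a\<close>. A complex square root is taken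
    because the sign of the discriminant is not known yet; the roots turn out real since the
    diagonalised matrix is Hermitian.\<close>
  define e1 where "e1 = (b + csqrt (b\<^sup>2 - 4 * a)) / 2"
  define e2 where "e2 = (b - csqrt (b\<^sup>2 - 4 * a)) / 2"
  have sum: "e1 + e2 = b" by (simp add: e1_def e2_def add_divide_distrib[symmetric])
  have "e1 * e2 = (b\<^sup>2 - (csqrt (b\<^sup>2 - 4 * a))\<^sup>2) / 4"
    by (simp add: e1_def e2_def power2_eq_square algebra_simps)
  then have prod: "e1 * e2 = a" by simp
  define es where "es = e1 # e2 # replicate (k - 2) 0"
  have "char_poly H = [:a, - b, 1:] * [:0, 1:] ^ (k - 2)"
    unfolding a_def b_def by (rule char_poly_of_det_quadratic[OF H(1) k det])
  also have "\<dots> = (\<Prod>x\<leftarrow>es. [:- x, 1:])"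
  proof -
    have "[:a, - b, 1:] = [:- e1, 1:] * [:- e2, 1:]"
      unfolding sum[symmetric] prod[symmetric] by simp
    then show ?thesis by (simp add: es_def prod_list_replicate mult.assoc del: mult_pCons_left mult_pCons_right)
  qed
  finally obtain U where U: "U \<in> carrier_mat k k" "mat_adjoint U * U = 1\<^sub>m k"
    and D: "mat_adjoint U * H * U = mat k k (\<lambda>(i, j). if i = j then es ! i else 0)" (is "_ = ?D")
    using hermitian_unitary_diagonalization[OF H] by blast
  have Dherm: "mat_adjoint ?D = ?D"
    using hermitian_conjugate[OF H U(1)] unfolding D .
  have real: "es ! i = complex_of_real (Re (es ! i))" if "i < k" for i
  proof -
    have "mat_adjoint ?D $$ (i, i) = cnj (es ! i)" using that by simp
    then have "cnj (es ! i) = es ! i" unfolding Dherm using that by simp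
    then show ?thesis by (simp add: complex_eq_iff)
  qed
  \<comment> \<open>The value 0 beyond the size of the matrix lets the vanishing for
    \<open>i \<ge> 2\<close> be stated without an upper bound.\<close>
  define d where "d i = (if i < k then Re (es ! i) else 0)" for i
  have e12: "e1 = of_real (d 0)" "e2 = of_real (d 1)"
    using real[of 0] real[of 1] k by (simp_all add: d_def es_def)
  have "d i = 0" if "i \<ge> 2" for i
    using that k by (auto simp: d_def es_def nth_Cons')
  moreover have "complex_of_real (d 0 + d 1) = of_real \<beta>" "complex_of_real (d 0 * d 1) = of_real \<alpha>"
    using sum prod unfolding e12 a_def b_def by simp_all
  then have "d 0 + d 1 = \<beta>" "d 0 * d 1 = \<alpha>" unfolding of_real_eq_iff .
  moreover have "?D = mat k k (\<lambda>(i, j). if i = j then complex_of_real (d i) else 0)"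
    by (rule eq_matI) (use real in \<open>auto simp: d_def\<close>)
  ultimately show ?thesis using U D by (intro exI[of _ U] exI[of _ d]) simp
qed

lemma diag_mat_mult:
  fixes f g :: "nat \<Rightarrow> 'a :: comm_ring_1"
  shows "mat k k (\<lambda>(i, j). if i = j then f i else 0) * mat k k (\<lambda>(i, j). if i = j then g i else 0)
    = mat k k (\<lambda>(i, j). if i = j then f i * g i else 0)"
proof (rule eq_matI)
  fix i j assume "i < dim_row (mat k k (\<lambda>(i, j). if i = j then f i * g i else 0))"
    "j < dim_col (mat k k (\<lambda>(i, j). if i = j then f i * g i else 0))"
  then have ij: "i < k" "j < k" by auto
  have "(\<Sum>a\<in>{0..<k}. (if i = a then f i else 0) * (if a = j then g a else 0))
      = (\<Sum>a\<in>{0..<k}. if a = i then (if i = j then f i * g i else 0) else 0)"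
    by (intro sum.cong) auto
  then show "(mat k k (\<lambda>(i, j). if i = j then f i else 0) * mat k k (\<lambda>(i, j). if i = j then g i else 0)) $$ (i, j)
      = mat k k (\<lambda>(i, j). if i = j then f i * g i else 0) $$ (i, j)"
    using ij by (simp add: scalar_prod_def)
qed auto

text \<open>Every eigenvalue is 0 or a root of \<open>z^2 - \<beta> z + \<alpha>\<close>, hence a
  root of \<open>z\<close> times this quadratic, and a diagonalisable matrix satisfies any
  polynomial that kills its eigenvalues. Unlike Cayley-Hamilton, the degree does not grow with
  \<open>k\<close>.\<close>

lemma hermitian_det_quadratic_cubic:
  fixes H :: "complex mat"
  assumes H: "H \<in> carrier_mat k k" "mat_adjoint H = H" and k: "2 \<le> k"
    and det: "\<And>t :: real. det (1\<^sub>m k + complex_of_real t \<cdot>\<^sub>m H) = 1 + of_real t * of_real \<beta> + (of_real t)\<^sup>2 * of_real \<alpha>"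
  shows "H * H * H = complex_of_real \<beta> \<cdot>\<^sub>m (H * H) - complex_of_real \<alpha> \<cdot>\<^sub>m H"
proof -
  obtain U d where U: "U \<in> carrier_mat k k" and UU: "mat_adjoint U * U = 1\<^sub>m k"
    and D: "mat_adjoint U * H * U = mat k k (\<lambda>(i, j). if i = j then complex_of_real (d i) else 0)"
    and d: "\<And>i. i \<ge> 2 \<Longrightarrow> d i = 0" "d 0 + d 1 = \<beta>" "d 0 * d 1 = \<alpha>"
    using hermitian_diagonalization_det_quadratic[OF assms] by blast
  define V where "V = mat_adjoint U"
  define D where "D = mat k k (\<lambda>(i, j). if i = j then complex_of_real (d i) else 0)"
  have V: "V \<in> carrier_mat k k" using U by (simp add: V_def)
  have Dc: "D \<in> carrier_mat k k" by (simp add: D_def)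
  have VU: "V * U = 1\<^sub>m k" using UU by (simp add: V_def)
  have UV: "U * V = 1\<^sub>m k" by (rule mat_mult_left_right_inverse[OF V U VU])
  note assoc = assoc_mult_mat[of _ k k _ k _ k]
  have HU: "H = U * D * V"
  proof -
    have "U * (V * H * U) * V = (U * V) * H * (U * V)" using U V H(1) by (simp add: assoc)
    then show ?thesis using D H(1) unfolding UV V_def[symmetric] D_def[symmetric] by simp
  qed
  have conj_mult: "(U * X * V) * (U * Y * V) = U * (X * Y) * V"
    if "X \<in> carrier_mat k k" "Y \<in> carrier_mat k k" for X Y
  proof -
    have "(U * X * V) * (U * Y * V) = U * X * (V * U) * (Y * V)" using U V that by (simp add: assoc)
    then show ?thesis using U V that by (simp add: VU assoc)
  qed
  have DDc: "D * D \<in> carrier_mat k k" using Dc by simp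
  have H2: "H * H = U * (D * D) * V" unfolding HU by (rule conj_mult[OF Dc Dc])
  have H3: "H * H * H = U * (D * D * D) * V"
    unfolding H2 by (subst HU) (rule conj_mult[OF DDc Dc])
  have root: "d i * d i * d i = \<beta> * (d i * d i) - \<alpha> * d i" for i
  proof -
    consider "i = 0" | "i = 1" | "i \<ge> 2" by linarith
    then show ?thesis using d by cases (auto simp: d(2)[symmetric] d(3)[symmetric] algebra_simps)
  qed
  have "D * D * D = complex_of_real \<beta> \<cdot>\<^sub>m (D * D) - complex_of_real \<alpha> \<cdot>\<^sub>m D"
  proof (rule eq_matI)
    fix i j assume "i < dim_row (complex_of_real \<beta> \<cdot>\<^sub>m (D * D) - complex_of_real \<alpha> \<cdot>\<^sub>m D)"
      "j < dim_col (complex_of_real \<beta> \<cdot>\<^sub>m (D * D) - complex_of_real \<alpha> \<cdot>\<^sub>m D)"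
    then have "i < k" "j < k" using Dc by auto
    then show "(D * D * D) $$ (i, j) = (complex_of_real \<beta> \<cdot>\<^sub>m (D * D) - complex_of_real \<alpha> \<cdot>\<^sub>m D) $$ (i, j)"
      using arg_cong[OF root[of i], of complex_of_real] unfolding D_def diag_mat_mult by (cases "i = j") simp_all
  qed (use Dc in auto)
  then have "H * H * H = U * (complex_of_real \<beta> \<cdot>\<^sub>m (D * D) - complex_of_real \<alpha> \<cdot>\<^sub>m D) * V"
    unfolding H3 by simp
  also have "\<dots> = complex_of_real \<beta> \<cdot>\<^sub>m (U * (D * D) * V) - complex_of_real \<alpha> \<cdot>\<^sub>m (U * D * V)"
  proof -
    have c1: "complex_of_real \<beta> \<cdot>\<^sub>m (D * D) \<in> carrier_mat k k" "complex_of_real \<alpha> \<cdot>\<^sub>m D \<in> carrier_mat k k"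
      using Dc DDc by auto
    have c2: "U * (D * D) \<in> carrier_mat k k" "U * D \<in> carrier_mat k k" using U Dc DDc by auto
    have c3: "complex_of_real \<beta> \<cdot>\<^sub>m (U * (D * D)) \<in> carrier_mat k k"
      "complex_of_real \<alpha> \<cdot>\<^sub>m (U * D) \<in> carrier_mat k k" using c2 by auto
    show ?thesis
      unfolding mult_minus_distrib_mat[OF U c1] mult_smult_distrib[OF U DDc] mult_smult_distrib[OF U Dc]
        minus_mult_distrib_mat[OF c3 V] mult_smult_assoc_mat[OF c2(1) V] mult_smult_assoc_mat[OF c2(2) V] ..
  qed
  finally show ?thesis unfolding H2[symmetric] HU[symmetric] .
qed

section \<open>Pencils and forms under change of basis, scaling and translation\<close>

lemma triple_mult_index:
  fixes V P U :: "'a :: comm_semiring_0 mat"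
  assumes "V \<in> carrier_mat k k" "P \<in> carrier_mat k k" "U \<in> carrier_mat k k" "r < k" "c < k"
  shows "(V * P * U) $$ (r, c) = (\<Sum>b<k. \<Sum>a<k. V $$ (r, a) * P $$ (a, b) * U $$ (b, c))"
proof -
  have mult: "(X * Y) $$ (i, j) = (\<Sum>b<k. X $$ (i, b) * Y $$ (b, j))"
    if "X \<in> carrier_mat k k" "Y \<in> carrier_mat k k" "i < k" "j < k" for X Y :: "'a mat" and i j
    using that by (simp add: scalar_prod_def atLeast0LessThan)
  have VP: "V * P \<in> carrier_mat k k" using assms by simp
  show ?thesis
    unfolding mult[OF VP assms(3-5)] using assms mult[OF assms(1,2,4)]
    by (intro sum.cong refl) (simp add: sum_distrib_right)
qed

text \<open>Unitarity keeps the constant term equal to the identity, so the conjugated pencil is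
  still monic.\<close>

lemma pencil_conjugate:
  assumes U: "U \<in> carrier_mat k k" "mat_adjoint U * U = 1\<^sub>m k"
    and As: "\<And>j. j < n \<Longrightarrow> As j \<in> carrier_mat k k"
  shows "pencil n k (\<lambda>j. mat_adjoint U * As j * U) x = mat_adjoint U * pencil n k As x * U"
    (is "?L = ?V * ?P * U")
proof (rule eq_matI)
  have V: "?V \<in> carrier_mat k k" using U by simp
  fix r c assume "r < dim_row (?V * ?P * U)" "c < dim_col (?V * ?P * U)"
  then have rc: "r < k" "c < k" using U by auto
  have "(?V * 1\<^sub>m k * U) $$ (r, c) = (1\<^sub>m k :: complex mat) $$ (r, c)"
    unfolding right_mult_one_mat[OF V] U(2) ..
  then have one: "(\<Sum>b<k. \<Sum>a<k. ?V $$ (r, a) * 1\<^sub>m k $$ (a, b) * U $$ (b, c)) = 1\<^sub>m k $$ (r, c)"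
    unfolding triple_mult_index[OF V one_carrier_mat U(1) rc] .
  have "(?V * ?P * U) $$ (r, c) = (\<Sum>b<k. \<Sum>a<k. ?V $$ (r, a) * 1\<^sub>m k $$ (a, b) * U $$ (b, c)
      + (\<Sum>j<n. complex_of_real (x $ j) * (?V $$ (r, a) * As j $$ (a, b) * U $$ (b, c))))"
    unfolding triple_mult_index[OF V pencil_carrier U(1) rc]
    by (intro sum.cong refl)
      (simp add: pencil_index distrib_left distrib_right sum_distrib_left sum_distrib_right mult_ac
        del: mat_adjoint_index)
  also have "\<dots> = 1\<^sub>m k $$ (r, c) + (\<Sum>b<k. \<Sum>a<k. \<Sum>j<n. complex_of_real (x $ j) * (?V $$ (r, a) * As j $$ (a, b) * U $$ (b, c)))"
    unfolding sum.distrib one ..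
  also have "(\<Sum>b<k. \<Sum>a<k. \<Sum>j<n. complex_of_real (x $ j) * (?V $$ (r, a) * As j $$ (a, b) * U $$ (b, c)))
      = (\<Sum>j<n. complex_of_real (x $ j) * (\<Sum>b<k. \<Sum>a<k. ?V $$ (r, a) * As j $$ (a, b) * U $$ (b, c)))"
    unfolding sum_distrib_left by (subst (2) sum.swap, subst sum.swap) simp
  also have "\<dots> = (\<Sum>j<n. complex_of_real (x $ j) * (?V * As j * U) $$ (r, c))"
    by (intro sum.cong refl) (simp add: triple_mult_index[OF V As U(1) rc] del: index_mult_mat(1) mat_adjoint_index)
  finally show "?L $$ (r, c) = (?V * ?P * U) $$ (r, c)"
    unfolding pencil_index[OF rc] using rc by simp
qed (use U in auto)

lemma pencil_scale:
  assumes "x \<in> carrier_vec n"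
  shows "pencil n k As (t \<cdot>\<^sub>v x)
    = 1\<^sub>m k + complex_of_real t \<cdot>\<^sub>m mat k k (\<lambda>(r, c). \<Sum>j<n. complex_of_real (x $ j) * As j $$ (r, c))"
  by (rule eq_matI) (use assms in \<open>auto simp: pencil_index sum_distrib_left mult.assoc\<close>)

lemma bilinear_form_add:
  fixes A :: "real mat"
  assumes A: "A \<in> carrier_mat n n" and x: "x \<in> carrier_vec n" and y: "y \<in> carrier_vec n"
  shows "(s \<cdot>\<^sub>v x + y) \<bullet> (A *\<^sub>v (s \<cdot>\<^sub>v x + y))
    = s\<^sup>2 * (x \<bullet> (A *\<^sub>v x)) + s * (x \<bullet> (A *\<^sub>v y) + y \<bullet> (A *\<^sub>v x)) + y \<bullet> (A *\<^sub>v y)"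
proof -
  have z: "s \<cdot>\<^sub>v x + y \<in> carrier_vec n" using x y by simp
  have "(s \<cdot>\<^sub>v x + y) \<bullet> (A *\<^sub>v (s \<cdot>\<^sub>v x + y)) = (\<Sum>i<n. \<Sum>j<n. s\<^sup>2 * (x $ i * A $$ (i, j) * x $ j)
      + s * (x $ i * A $$ (i, j) * y $ j + y $ i * A $$ (i, j) * x $ j) + y $ i * A $$ (i, j) * y $ j)"
    unfolding quad_form_eq_sum[OF A z z]
    using x y by (intro sum.cong refl) (simp add: algebra_simps power2_eq_square)
  also have "\<dots> = s\<^sup>2 * (x \<bullet> (A *\<^sub>v x)) + s * (x \<bullet> (A *\<^sub>v y) + y \<bullet> (A *\<^sub>v x)) + y \<bullet> (A *\<^sub>v y)"
    unfolding quad_form_eq_sum[OF A x x] quad_form_eq_sum[OF A x y] quad_form_eq_sum[OF A y x] quad_form_eq_sum[OF A y y]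
    by (simp add: sum.distrib flip: sum_distrib_left)
  finally show ?thesis .
qed

text \<open>The instances \<open>s = 1, -1, 0\<close> determine a quadratic polynomial. The left
  side has no quadratic term, whence \<open>a * h = 0\<close>; the linear terms give
  \<open>X = D * W - g * h\<close>.\<close>

lemma quadratic_identity_coeffs:
  fixes X C D B W a g c h :: complex
  assumes "\<And>s :: real. of_real s * X + C = (of_real s * D + B) * W - ((of_real s)\<^sup>2 * a + of_real s * g + c) * h"
  shows "a * h = 0" and "h = 0 \<Longrightarrow> X = D * W"
proof -
  have e: "X + C = (D + B) * W - (a + g + c) * h" "- X + C = (- D + B) * W - (a - g + c) * h"
    "C = B * W - c * h"
    using assms[of 1] assms[of "- 1"] assms[of 0] by simp_all
  have "2 * C = 2 * (B * W) - 2 * ((a + c) * h)"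
    using arg_cong2[where f = "(+)", OF e(1,2)] by (simp add: algebra_simps)
  then show "a * h = 0" unfolding e(3) by (simp add: algebra_simps)
  assume "h = 0"
  with arg_cong2[where f = "(-)", OF e(1,2)] show "X = D * W" by (simp add: algebra_simps)
qed

text \<open>Column \<open>i\<close> of \<open>s D + H\<close> does not depend on \<open>s\<close>, so the \<open>(i, i)\<close> entry of the cubic identity is a
  polynomial identity in \<open>s\<close>. Its quadratic coefficient kills \<open>H\<^sub>i\<^sub>i\<close>; its linear coefficient says that
  \<open>\<Sum>\<^sub>a (d\<^sub>0 + d\<^sub>1 - d\<^sub>a) |H\<^sub>i\<^sub>a|\<^sup>2 = 0\<close>, where all weights have the same strict sign.\<close>

lemma cubic_pencil_row_zero:
  fixes H :: "complex mat" and d :: "nat \<Rightarrow> real"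
  assumes H: "H \<in> carrier_mat k k" "mat_adjoint H = H"
    and d: "\<And>i. i \<ge> 2 \<Longrightarrow> d i = 0" "d 0 * d 1 > 0"
    and cubic: "\<And>s G. G = mat k k (\<lambda>(r, c). complex_of_real s * (if r = c then complex_of_real (d r) else 0) + H $$ (r, c))
      \<Longrightarrow> G * G * G = complex_of_real (s * (d 0 + d 1) + \<beta>) \<cdot>\<^sub>m (G * G)
          - complex_of_real (s\<^sup>2 * (d 0 * d 1) + s * \<gamma> + \<alpha>) \<cdot>\<^sub>m G"
    and i: "2 \<le> i" "i < k" and a: "a < k"
  shows "H $$ (i, a) = 0"
proof -
  have cnj: "H $$ (a, i) = cnj (H $$ (i, a))" if "a < k" for a
    using mat_adjoint_index[of a H i] H i that by simp
  define w where "w a = (cmod (H $$ (i, a)))\<^sup>2" for a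
  have w: "H $$ (i, a) * H $$ (a, i) = complex_of_real (w a)" if "a < k" for a
    unfolding cnj[OF that] w_def by (rule complex_norm_square[symmetric])
  define X where "X = (\<Sum>a<k. d a * w a)"
  define W where "W = (\<Sum>a<k. w a)"
  define C where "C = (\<Sum>b<k. \<Sum>a<k. H $$ (i, a) * H $$ (a, b) * H $$ (b, i))"
  define h where "h = H $$ (i, i)"
  have E: "of_real (s * X) + C = of_real ((s * (d 0 + d 1) + \<beta>) * W)
      - complex_of_real (s\<^sup>2 * (d 0 * d 1) + s * \<gamma> + \<alpha>) * h" for s
  proof -
    define G where "G = mat k k (\<lambda>(r, c). complex_of_real s * (if r = c then complex_of_real (d r) else 0) + H $$ (r, c))"
    note eq = cubic[OF G_def]
    have Gc: "G \<in> carrier_mat k k" by (simp add: G_def)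
    have row: "G $$ (i, a) = H $$ (i, a)" "G $$ (a, i) = H $$ (a, i)" if "a < k" for a
      using that i d(1) by (auto simp: G_def)
    \<comment> \<open>The outer factors lie in row and column \<open>i\<close>, where
      \<open>d i = 0\<close>, so \<open>s\<close> enters only through the middle factor: the entry
      of the cube is affine in \<open>s\<close>, that of the square is constant.\<close>
    have "(G * G * G) $$ (i, i) = (\<Sum>b<k. \<Sum>a<k. H $$ (i, a) * H $$ (a, b) * H $$ (b, i)
        + (if a = b then complex_of_real s * (complex_of_real (d a) * (H $$ (i, a) * H $$ (a, i))) else 0))"
      unfolding triple_mult_index[OF Gc Gc Gc i(2) i(2)]
      by (intro sum.cong refl) (simp add: row, simp add: G_def algebra_simps)
    also have "\<dots> = C + (\<Sum>b<k. complex_of_real s * (complex_of_real (d b) * (H $$ (i, b) * H $$ (b, i))))"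
      unfolding sum.distrib C_def by simp
    also have "(\<Sum>b<k. complex_of_real s * (complex_of_real (d b) * (H $$ (i, b) * H $$ (b, i)))) = of_real (s * X)"
      by (simp add: w X_def sum_distrib_left)
    finally have lhs: "(G * G * G) $$ (i, i) = C + of_real (s * X)" .
    have "(G * G) $$ (i, i) = (\<Sum>a<k. H $$ (i, a) * H $$ (a, i))"
      using Gc i row by (simp add: scalar_prod_def atLeast0LessThan)
    also have "\<dots> = of_real W" by (simp add: w W_def)
    finally have "(G * G) $$ (i, i) = of_real W" .
    then have "(G * G * G) $$ (i, i) = of_real ((s * (d 0 + d 1) + \<beta>) * W)
      - complex_of_real (s\<^sup>2 * (d 0 * d 1) + s * \<gamma> + \<alpha>) * h"
      unfolding eq using Gc i row(1)[OF i(2)] by (simp add: h_def del: index_mult_mat(1))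
    with lhs show ?thesis by (simp add: add.commute)
  qed
  have E': "of_real s * of_real X + C = (of_real s * of_real (d 0 + d 1) + of_real \<beta>) * of_real W
      - ((of_real s)\<^sup>2 * complex_of_real (d 0 * d 1) + of_real s * of_real \<gamma> + of_real \<alpha>) * h" for s :: real
    using E[of s] by simp
  have "complex_of_real (d 0 * d 1) * h = 0" by (rule quadratic_identity_coeffs(1)[OF E'])
  then have h: "h = 0" using d(2) by auto
  have "complex_of_real X = of_real (d 0 + d 1) * of_real W" by (rule quadratic_identity_coeffs(2)[OF E' h])
  then have "X = (d 0 + d 1) * W" unfolding of_real_mult[symmetric] of_real_eq_iff .
  \<comment> \<open>The weight \<open>d 0 + d 1 - d a\<close> equals \<open>d 1\<close>,
    \<open>d 0\<close> or \<open>d 0 + d 1\<close>. The extra factor \<open>d 0\<close> makes all of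
    them positive, whichever sign the two eigenvalues share.\<close>
  then have "(\<Sum>a<k. d 0 * (d 0 + d 1 - d a) * w a) = 0"
    unfolding X_def W_def by (simp add: sum_distrib_left[symmetric] left_diff_distrib sum_subtractf mult.assoc)
  moreover have pos: "d 0 * (d 0 + d 1 - d a) > 0" for a
  proof -
    have nz: "d 0 \<noteq> 0" using d(2) by auto
    consider "a = 0" | "a = 1" | "a \<ge> 2" by linarith
    then show ?thesis
    proof cases
      case 3
      have "d 0 * d 0 > 0" using nz by (metis not_real_square_gt_zero)
      then show ?thesis using 3 d by (simp add: distrib_left)
    next
      case 2
      have "d 0 * d 0 > 0" using nz by (metis not_real_square_gt_zero)
      then show ?thesis using 2 by simp
    qed (use d(2) in simp)
  qed
  moreover have "d 0 * (d 0 + d 1 - d a) * w a \<ge> 0" for a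
    by (rule mult_nonneg_nonneg[OF less_imp_le[OF pos]]) (simp add: w_def)
  ultimately have "\<forall>a\<in>{..<k}. d 0 * (d 0 + d 1 - d a) * w a = 0"
    using sum_nonneg_eq_0_iff[of "{..<k}" "\<lambda>a. d 0 * (d 0 + d 1 - d a) * w a"] by blast
  then have "d 0 * (d 0 + d 1 - d a) * w a = 0" using a by blast
  then have "w a = 0" using pos[of a] by (metis mult_eq_0_iff less_irrefl)
  then show ?thesis by (simp add: w_def)
qed

lemma mhdr_not_neg_semidef_imp_mhdr_2:
  assumes A: "A \<in> carrier_mat n n" and b: "b \<in> carrier_vec n"
    and rep: "has_mhdr n (quad_poly A b) k" and nsd: "\<not> neg_semidef n A"
  shows "has_mhdr n (quad_poly A b) 2"
proof -
  from nsd A obtain x0 where x0: "x0 \<in> carrier_vec n" "x0 \<bullet> (A *\<^sub>v x0) > 0"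
    unfolding neg_semidef_def by (auto simp: not_le)
  from rep obtain As where As: "\<And>j. j < n \<Longrightarrow> As j \<in> carrier_mat k k" "\<And>j. j < n \<Longrightarrow> hermitian_mat (As j)"
    and det: "\<And>x. x \<in> carrier_vec n \<Longrightarrow> complex_of_real (quad_poly A b x) = det (pencil n k As x)"
    unfolding has_mhdr_def by blast
  \<comment> \<open>The linear part of the pencil, as a function of the coefficient family because
    it is used both before and after the unitary change of basis.\<close>
  define L where "L As x = mat k k (\<lambda>(r, c). \<Sum>j<n. complex_of_real (x $ j) * (As :: nat \<Rightarrow> complex mat) j $$ (r, c))"
    for As x
  have Lc: "L As x \<in> carrier_mat k k" for As x by (simp add: L_def)
  have Lherm: "mat_adjoint (L As x) = L As x"
    if As: "\<And>j. j < n \<Longrightarrow> As j \<in> carrier_mat k k" "\<And>j. j < n \<Longrightarrow> hermitian_mat (As j)" for As x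
  proof -
    have "hermitian_mat (L As x)"
    proof (rule hermitian_matI[OF Lc])
      fix r c assume rc: "r < k" "c < k"
      have "cnj (As j $$ (c, r)) = As j $$ (r, c)" if "j < n" for j
        using hermitian_mat_index[OF As(2)[OF that] As(1)[OF that] rc] by simp
      then show "L As x $$ (r, c) = cnj (L As x $$ (c, r))" using rc by (simp add: L_def)
    qed
    then show ?thesis by (simp add: hermitian_mat_def)
  qed
  have Ldet: "det (1\<^sub>m k + complex_of_real t \<cdot>\<^sub>m L As x)
      = 1 + of_real t * of_real (b \<bullet> x) + (of_real t)\<^sup>2 * of_real (x \<bullet> (A *\<^sub>v x))"
    if "\<And>x. x \<in> carrier_vec n \<Longrightarrow> complex_of_real (quad_poly A b x) = det (pencil n k As x)"
      and x: "x \<in> carrier_vec n" for As x t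
    using that(1)[of "t \<cdot>\<^sub>v x"] x
    unfolding quad_poly_scale[OF A b x] pencil_scale[OF x] L_def by simp
  have A_herm: "mat_adjoint (L As x) = L As x" for x
    by (rule Lherm) (use As in auto)
  have A_det: "det (1\<^sub>m k + complex_of_real t \<cdot>\<^sub>m L As x0)
      = 1 + of_real t * of_real (b \<bullet> x0) + (of_real t)\<^sup>2 * of_real (x0 \<bullet> (A *\<^sub>v x0))" for t
    by (rule Ldet) (use det x0 in auto)
  \<comment> \<open>A determinant of size 0 or 1 is affine in \<open>t\<close>, but the coefficient
    of \<open>t^2\<close> at \<open>x0\<close> is positive.\<close>
  have k: "2 \<le> k"
  proof (rule ccontr)
    assume "\<not> 2 \<le> k"
    then consider "k = 0" | "k = 1" by linarith
    then have "\<exists>m. \<forall>t :: real. det (1\<^sub>m k + complex_of_real t \<cdot>\<^sub>m L As x0) = 1 + of_real t * m"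
    proof cases
      case 1
      then show ?thesis using Lc[of As x0] by (intro exI[of _ 0]) (simp add: det_dim_zero)
    next
      case 2
      then show ?thesis using Lc[of As x0]
        by (intro exI[of _ "L As x0 $$ (0, 0)"]) (auto simp: det_single)
    qed
    then obtain m where "\<And>t :: real. det (1\<^sub>m k + complex_of_real t \<cdot>\<^sub>m L As x0) = 1 + of_real t * m"
      by blast
    then have m: "1 + of_real t * of_real (b \<bullet> x0) + (of_real t)\<^sup>2 * complex_of_real (x0 \<bullet> (A *\<^sub>v x0))
        = 1 + of_real t * m" for t :: real
      unfolding A_det .
    have e: "of_real (b \<bullet> x0) + complex_of_real (x0 \<bullet> (A *\<^sub>v x0)) = m"
      "- of_real (b \<bullet> x0) + complex_of_real (x0 \<bullet> (A *\<^sub>v x0)) = - m"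
      using m[of 1] m[of "- 1"] by simp_all
    have "2 * complex_of_real (x0 \<bullet> (A *\<^sub>v x0)) = 0"
      using arg_cong2[where f = "(+)", OF e] by simp
    then show False using x0(2) by simp
  qed
  obtain U d where U: "U \<in> carrier_mat k k" and UU: "mat_adjoint U * U = 1\<^sub>m k"
    and D: "mat_adjoint U * L As x0 * U = mat k k (\<lambda>(i, j). if i = j then complex_of_real (d i) else 0)"
    and d: "\<And>i. i \<ge> 2 \<Longrightarrow> d i = 0" "d 0 + d 1 = b \<bullet> x0" "d 0 * d 1 = x0 \<bullet> (A *\<^sub>v x0)"
    using hermitian_diagonalization_det_quadratic[OF Lc A_herm k A_det] by blast
  have V: "mat_adjoint U \<in> carrier_mat k k" using U by simp
  define Bs where "Bs j = mat_adjoint U * As j * U" for j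
  have Bs: "Bs j \<in> carrier_mat k k" "hermitian_mat (Bs j)" if "j < n" for j
  proof -
    show c: "Bs j \<in> carrier_mat k k" unfolding Bs_def by (rule mult_carrier_mat[OF mult_carrier_mat[OF V As(1)[OF that]] U])
    have "mat_adjoint (As j) = As j" using As(2)[OF that] by (simp add: hermitian_mat_def)
    then have "mat_adjoint (Bs j) = Bs j"
      unfolding Bs_def by (rule hermitian_conjugate[OF As(1)[OF that] _ U])
    then show "hermitian_mat (Bs j)" using c by (simp add: hermitian_mat_def)
  qed
  have PB: "pencil n k Bs x = mat_adjoint U * pencil n k As x * U" for x
    unfolding Bs_def by (rule pencil_conjugate[OF U UU As(1)])
  have detB: "complex_of_real (quad_poly A b x) = det (pencil n k Bs x)" if x: "x \<in> carrier_vec n" for x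
  proof -
    have "det (pencil n k Bs x) = det (mat_adjoint U) * det (pencil n k As x) * det U"
      unfolding PB using det_mult[OF mult_carrier_mat[OF V pencil_carrier] U] det_mult[OF V pencil_carrier] by simp
    also have "\<dots> = det (mat_adjoint U * U) * det (pencil n k As x)"
      unfolding det_mult[OF V U] by simp
    finally show ?thesis using det[OF x] UU by simp
  qed
  have LB0: "L Bs x0 = mat k k (\<lambda>(i, j). if i = j then complex_of_real (d i) else 0)"
  proof -
    have P: "pencil n k Cs x0 = 1\<^sub>m k + L Cs x0" for Cs
      by (rule eq_matI) (auto simp: pencil_index L_def)
    have "1\<^sub>m k + L Bs x0 = mat_adjoint U * (1\<^sub>m k + L As x0) * U"
      using PB[of x0] unfolding P .
    also have "\<dots> = 1\<^sub>m k + mat_adjoint U * L As x0 * U"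
    proof -
      have VL: "mat_adjoint U * L As x0 \<in> carrier_mat k k" using V Lc by simp
      show ?thesis
        unfolding mult_add_distrib_mat[OF V one_carrier_mat Lc] right_mult_one_mat[OF V]
          add_mult_distrib_mat[OF V VL U] UU ..
    qed
    finally have eq: "1\<^sub>m k + L Bs x0 = 1\<^sub>m k + mat_adjoint U * L As x0 * U" .
    have "X = Y" if "1\<^sub>m k + X = 1\<^sub>m k + Y" "X \<in> carrier_mat k k" "Y \<in> carrier_mat k k" for X Y :: "complex mat"
    proof (rule eq_matI)
      fix r c assume "r < dim_row Y" "c < dim_col Y"
      then show "X $$ (r, c) = Y $$ (r, c)"
        using arg_cong[OF that(1), of "\<lambda>M. M $$ (r, c)"] that(2,3) by simp
    qed (use that in auto)
    from this[OF eq Lc mult_carrier_mat[OF mult_carrier_mat[OF V Lc] U]]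
    have "L Bs x0 = mat_adjoint U * L As x0 * U" .
    then show ?thesis unfolding D .
  qed
  have support: "L Bs x $$ (i, a) = 0" "L Bs x $$ (a, i) = 0"
    if x: "x \<in> carrier_vec n" and ia: "2 \<le> i" "i < k" "a < k" for x i a
  proof -
    have herm: "mat_adjoint (L Bs y) = L Bs y" for y
      by (rule Lherm) (use Bs in auto)
    have B_det: "det (1\<^sub>m k + complex_of_real t \<cdot>\<^sub>m L Bs y)
        = 1 + of_real t * of_real (b \<bullet> y) + (of_real t)\<^sup>2 * of_real (y \<bullet> (A *\<^sub>v y))"
      if "y \<in> carrier_vec n" for t y
      by (rule Ldet) (use detB that in auto)
    let ?\<gamma> = "x0 \<bullet> (A *\<^sub>v x) + x \<bullet> (A *\<^sub>v x0)"
    show 0: "L Bs x $$ (i, a) = 0"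
    \<comment> \<open>The parameters describe the point \<open>s x0 + x\<close>: there the linear
      part is \<open>s\<close> times the diagonal matrix plus \<open>L Bs x\<close>, and \<gamma> is
      the mixed term of the quadratic form.\<close>
    proof (rule cubic_pencil_row_zero[where d = d and \<beta> = "b \<bullet> x" and \<gamma> = ?\<gamma> and \<alpha> = "x \<bullet> (A *\<^sub>v x)"])
      show "d 0 * d 1 > 0" using d(3) x0(2) by simp
    next
      fix s G
      assume G: "G = mat k k (\<lambda>(r, c). complex_of_real s * (if r = c then complex_of_real (d r) else 0) + L Bs x $$ (r, c))"
      have y: "s \<cdot>\<^sub>v x0 + x \<in> carrier_vec n" using x x0 by simp
      have "L Bs (s \<cdot>\<^sub>v x0 + x) $$ (r, c) = complex_of_real s * L Bs x0 $$ (r, c) + L Bs x $$ (r, c)"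
        if "r < k" "c < k" for r c
        using that x x0(1) by (simp add: L_def distrib_right sum.distrib sum_distrib_left mult.assoc)
      then have G': "G = L Bs (s \<cdot>\<^sub>v x0 + x)"
        unfolding G using Lc[of Bs "s \<cdot>\<^sub>v x0 + x"] by (intro eq_matI) (auto simp: LB0)
      have by': "b \<bullet> (s \<cdot>\<^sub>v x0 + x) = s * (d 0 + d 1) + b \<bullet> x"
        unfolding d(2) using b x x0(1) by (simp add: scalar_prod_add_distrib[of _ n])
      have qy: "(s \<cdot>\<^sub>v x0 + x) \<bullet> (A *\<^sub>v (s \<cdot>\<^sub>v x0 + x)) = s\<^sup>2 * (d 0 * d 1) + s * ?\<gamma> + x \<bullet> (A *\<^sub>v x)"
        unfolding bilinear_form_add[OF A x0(1) x] d(3) ..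
      show "G * G * G = complex_of_real (s * (d 0 + d 1) + b \<bullet> x) \<cdot>\<^sub>m (G * G)
          - complex_of_real (s\<^sup>2 * (d 0 * d 1) + s * ?\<gamma> + x \<bullet> (A *\<^sub>v x)) \<cdot>\<^sub>m G"
        unfolding by'[symmetric] qy[symmetric] G'
        by (rule hermitian_det_quadratic_cubic[OF Lc herm k B_det[OF y]])
    qed (use Lc herm d(1) ia in auto)
    have "L Bs x $$ (a, i) = cnj (L Bs x $$ (i, a))"
      using mat_adjoint_index[of a "L Bs x" i] herm[of x] Lc[of Bs x] ia by simp
    then show "L Bs x $$ (a, i) = 0" using 0 by simp
  qed
  define Cs where "Cs j = mat 2 2 (\<lambda>(r, c). Bs j $$ (r, c))" for j
  show ?thesis
    unfolding has_mhdr_def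
  proof (intro exI[of _ Cs] conjI allI impI ballI)
    fix j assume j: "j < n"
    show c: "Cs j \<in> carrier_mat 2 2" by (simp add: Cs_def)
    show "hermitian_mat (Cs j)"
    proof (rule hermitian_matI[OF c])
      fix r c :: nat assume rc: "r < 2" "c < 2"
      then show "Cs j $$ (r, c) = cnj (Cs j $$ (c, r))"
        using hermitian_mat_index[OF Bs(2,1)[OF j], of r c] k by (simp add: Cs_def)
    qed
  next
    fix x :: "real vec" assume x: "x \<in> carrier_vec n"
    obtain m where km: "k = 2 + m" using k le_Suc_ex by blast
    \<comment> \<open>Outside the upper left block only the constant identity term of the pencil
      survives, and it contributes the factor 1.\<close>
    have "pencil n k Bs x = four_block_mat (pencil n 2 Cs x) (0\<^sub>m 2 m) (0\<^sub>m m 2) (1\<^sub>m m)"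
    proof (rule eq_matI)
      fix r c assume "r < dim_row (four_block_mat (pencil n 2 Cs x) (0\<^sub>m 2 m) (0\<^sub>m m 2) (1\<^sub>m m))"
        "c < dim_col (four_block_mat (pencil n 2 Cs x) (0\<^sub>m 2 m) (0\<^sub>m m 2) (1\<^sub>m m))"
      then have rc: "r < k" "c < k" by (auto simp: km)
      have "(\<Sum>j<n. complex_of_real (x $ j) * Bs j $$ (r, c)) = L Bs x $$ (r, c)"
        using rc by (simp add: L_def)
      moreover have "L Bs x $$ (r, c) = 0" if "\<not> (r < 2 \<and> c < 2)"
        using support[OF x, of r c] support[OF x, of c r] rc that by (cases "r < 2") auto
      ultimately show "pencil n k Bs x $$ (r, c)
          = four_block_mat (pencil n 2 Cs x) (0\<^sub>m 2 m) (0\<^sub>m m 2) (1\<^sub>m m) $$ (r, c)"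
        using rc by (auto simp: km pencil_index Cs_def)
    qed (auto simp: km)
    then have "det (pencil n k Bs x) = det (pencil n 2 Cs x) * det (1\<^sub>m m)"
      by (simp only:) (rule det_four_block_mat_lower_left_zero, auto)
    then show "complex_of_real (quad_poly A b x) = det (pencil n 2 Cs x)"
      using detB[OF x] by simp
  qed
qed

section \<open>Sufficiency of the two conditions, and the equivalence\<close>

lemma neg_semidef_imp_mhdr:
  assumes A: "A \<in> carrier_mat n n" "A\<^sup>T = A" and b: "b \<in> carrier_vec n" and nsd: "neg_semidef n A"
  shows "has_mhdr n (quad_poly A b) (Suc n)"
proof -
  have uA: "- A \<in> carrier_mat n n" using A by simp
  have q: "x \<bullet> (- A *\<^sub>v x) = - (x \<bullet> (A *\<^sub>v x))" if x: "x \<in> carrier_vec n" for x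
    unfolding quad_form_eq_sum[OF uA x x] quad_form_eq_sum[OF A(1) x x] using A by (simp add: sum_negf)
  \<comment> \<open>The number of columns bounds the rank, so \<open>n\<close> squares suffice; with
    the corner this gives size \<open>n + 1\<close>.\<close>
  obtain l where l: "\<And>i. l i \<in> carrier_vec n"
    "\<And>x. x \<in> carrier_vec n \<Longrightarrow> x \<bullet> (- A *\<^sub>v x) = (\<Sum>i<n. (l i \<bullet> x)\<^sup>2)"
    using psd_sum_of_squares[OF uA, of n] symmetric_mat_index[OF A] nsd q A(1)
      vec_space.rank_le_nc[OF uA] unfolding neg_semidef_def by fastforce
  have "x \<bullet> (A *\<^sub>v x) = - (\<Sum>i<n. (l i \<bullet> x)\<^sup>2)" if "x \<in> carrier_vec n" for x
    using l(2)[OF that] q[OF that] by simp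
  then show ?thesis
    by (intro mhdr_of_affine_minus_squares[where l = l, OF b l(1)]) (simp add: quad_poly_def)
qed

lemma rank_le_3_imp_mhdr_2:
  assumes A: "A \<in> carrier_mat n n" "A\<^sup>T = A" and b: "b \<in> carrier_vec n"
    and nsd: "neg_semidef n (A - (1/4) \<cdot>\<^sub>m outer_prod b)"
    and rk: "vec_space.rank n (A - (1/4) \<cdot>\<^sub>m outer_prod b) \<le> 3"
  shows "has_mhdr n (quad_poly A b) 2"
proof -
  define M where "M = A - (1/4) \<cdot>\<^sub>m outer_prod b"
  have M: "M \<in> carrier_mat n n" using A b by (auto simp: M_def outer_prod_def)
  have uM: "- M \<in> carrier_mat n n" using M by simp
  have q: "x \<bullet> (- M *\<^sub>v x) = - (x \<bullet> (M *\<^sub>v x))" if x: "x \<in> carrier_vec n" for x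
    unfolding quad_form_eq_sum[OF uM x x] quad_form_eq_sum[OF M x x] using M by (simp add: sum_negf)
  have sym: "(- M) $$ (i, j) = (- M) $$ (j, i)" if "i < n" "j < n" for i j
  proof -
    have "M $$ (i, j) = M $$ (j, i)"
      using that symmetric_mat_index[OF A that] by (simp add: M_def shifted_mat_index[OF A b])
    then show ?thesis using that M by simp
  qed
  have "vec_space.rank n (- M) \<le> 3"
    using rk rank_uminus_le[OF M] by (simp add: M_def)
  then obtain l :: "nat \<Rightarrow> real vec" where l: "\<And>i. l i \<in> carrier_vec n"
    "\<And>x. x \<in> carrier_vec n \<Longrightarrow> x \<bullet> (- M *\<^sub>v x) = (\<Sum>i<3. (l i \<bullet> x)\<^sup>2)"
    using psd_sum_of_squares[OF uM, of 3] sym nsd[folded M_def] q unfolding neg_semidef_def by fastforce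
  show ?thesis
  proof (rule mhdr_of_square_minus_three_squares[where l = l, OF b l(1)])
    fix x :: "real vec" assume x: "x \<in> carrier_vec n"
    have "x \<bullet> (A *\<^sub>v x) - (b \<bullet> x)\<^sup>2 / 4 = - (\<Sum>i<3. (l i \<bullet> x)\<^sup>2)"
      using l(2)[OF x] q[OF x] shifted_quad_form[OF A(1) b x] unfolding M_def by simp
    then show "quad_poly A b x = (1 + b \<bullet> x / 2)\<^sup>2 - (\<Sum>i<3. (l i \<bullet> x)\<^sup>2)"
      by (simp add: quad_poly_def power2_eq_square algebra_simps)
  qed
qed

theorem mainTheorem8:
  fixes n :: nat and A :: "real mat" and b :: "real vec"
  assumes "A \<in> carrier_mat n n" and "A\<^sup>T = A" and "b \<in> carrier_vec n"
  shows "((\<exists>k\<ge>1. has_mhdr n (quad_poly A b) k) \<longleftrightarrow>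
           (neg_semidef n A \<or>
            (neg_semidef n (A - (1/4) \<cdot>\<^sub>m outer_prod b) \<and>
             vec_space.rank n (A - (1/4) \<cdot>\<^sub>m outer_prod b) \<le> 3)))
       \<and> ((\<not> neg_semidef n A \<and> (\<exists>k\<ge>1. has_mhdr n (quad_poly A b) k))
           \<longrightarrow> has_mhdr n (quad_poly A b) 2)"
proof -
  \<comment> \<open>The two sizes that witness existence: \<open>Suc n\<close> in case (1), 2 in
    case (2).\<close>
  have "(1::nat) \<le> Suc n" "(1::nat) \<le> 2" by auto
  then show ?thesis
    using neg_semidef_imp_mhdr[OF assms] rank_le_3_imp_mhdr_2[OF assms] mhdr_2_imp_rank_le_3[OF assms]
      mhdr_not_neg_semidef_imp_mhdr_2[OF assms(1,3)] by blast
qed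

end
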